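(* Let $n,t,\kappa$ be positive integers with $\kappa t\le n$. Every $(t,\kappa)$-doped fermionic Gaussian state $|\psi\rangle$ on $n$ qubits is $\kappa t$-compressible; that is, there exist a Gaussian unitary $G$ on $n$ qubits and a pure state $|\phi\rangle$ on the first $\kappa t$ qubits such that $$|\psi\rangle = G\left(|\phi\rangle\otimes|0^{n-\kappa t}\rangle\right).$$
   Context: On $n$ qubits with Pauli operators $X_k,Y_k,Z_k$, the Majorana operators are $\gamma_{2k-1}:=(\prod_{j=1}^{k-1}Z_j)X_k$ and $\gamma_{2k}:=(\prod_{j=1}^{k-1}Z_j)Y_k$, $k\in[n]:=\{1,\dots,n\}$. A (fermionic) Gaussian unitary is a unitary $G$ for which there is an orthogonal matrix $O\in\mathrm{O}(2n)$ with $G^\dagger\gamma_\mu G=\sum_{\nu=1}^{2n}O_{\mu,\nu}\gamma_\nu$ for all $\mu\in[2n]$. A $\kappa$-local gate is a unitary generated by at most $\kappa$ distinct Majorana operators, i.e. a unitary of the form $e^{iH}$ with $H$ a Hermitian operator in the algebra generated by $\kappa$ fixed Majorana operators $\gamma_{\mu(1)},\dots,\gamma_{\mu(\kappa)}$ (which operators are used may differ from gate to gate; the gate need not be Gaussian). A pure $n$-qubit state $|\psi\rangle$ is a $(t,\kappa)$-doped Gaussian state if $|\psi\rangle=G_tW_t\cdots G_1W_1G_0|0^n\rangle$ with $G_0,\dots,G_t$ Gaussian unitaries and $W_1,\dots,W_t$ $\kappa$-local gates. For $s\in[n]$, a pure state is (Gaussian) $s$-compressible if it equals $G(|\phi\rangle\otimes|0^{n-s}\rangle)$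 for some Gaussian unitary $G$ and some pure state $|\phi\rangle$ on the first $s$ qubits. *)

theory Defs
  imports Complex_Main "Jordan_Normal_Form.Schur_Decomposition"
begin

section \<open>Matrices\<close>

definition kron_mat :: "complex mat \<Rightarrow> complex mat \<Rightarrow> complex mat" where
  "kron_mat A B = mat (dim_row A * dim_row B) (dim_col A * dim_col B)
     (\<lambda>(i, j). A $$ (i div dim_row B, j div dim_col B) * B $$ (i mod dim_row B, j mod dim_col B))"

definition kron_vec :: "complex vec \<Rightarrow> complex vec \<Rightarrow> complex vec" where
  "kron_vec v w = vec (dim_vec v * dim_vec w)
     (\<lambda>i. v $ (i div dim_vec w) * w $ (i mod dim_vec w))"

definition unitary_mat :: "nat \<Rightarrow> complex mat \<Rightarrow> bool" where
  "unitary_mat d U \<longleftrightarrow> U \<in> carrier_mat d d \<and>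
     mat_adjoint U * U = 1\<^sub>m d \<and> U * mat_adjoint U = 1\<^sub>m d"

definition hermitian_mat :: "nat \<Rightarrow> complex mat \<Rightarrow> bool" where
  "hermitian_mat d H \<longleftrightarrow> H \<in> carrier_mat d d \<and> mat_adjoint H = H"

text \<open>The library predicate \<^const>\<open>orthogonal_mat\<close> only asks for pairwise orthogonal nonzero
  columns, without normalization, so the orthogonal group is introduced separately.\<close>

definition orthogonal_group :: "nat \<Rightarrow> real mat set" where
  "orthogonal_group m = {Q \<in> carrier_mat m m.
     transpose_mat Q * Q = 1\<^sub>m m \<and> Q * transpose_mat Q = 1\<^sub>m m}"

text \<open>Matrices of unspecified dimension have no zero element, so finite sums of
  \<open>d \<times> d\<close> matrices are formed entrywise.\<close>

definition mat_sum :: "nat \<Rightarrow> ('i \<Rightarrow> complex mat) \<Rightarrow> 'i set \<Rightarrow> complex mat" where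
  "mat_sum d f I = mat d d (\<lambda>(i, j). \<Sum>k\<in>I. f k $$ (i, j))"

text \<open>The exponential power series, convergent entrywise for every square matrix.\<close>

definition mat_exp :: "complex mat \<Rightarrow> complex mat" where
  "mat_exp A = mat (dim_row A) (dim_row A)
     (\<lambda>(i, j). \<Sum>k. (A ^\<^sub>m k) $$ (i, j) / fact k)"

inductive_set generated_algebra :: "nat \<Rightarrow> complex mat set \<Rightarrow> complex mat set"
  for d :: nat and S :: "complex mat set" where
  one: "1\<^sub>m d \<in> generated_algebra d S"
| gen: "A \<in> S \<Longrightarrow> A \<in> generated_algebra d S"
| add: "A \<in> generated_algebra d S \<Longrightarrow> B \<in> generated_algebra d S \<Longrightarrow> A + B \<in> generated_algebra d S"
| smult: "A \<in> generated_algebra d S \<Longrightarrow> c \<cdot>\<^sub>m A \<in> generated_algebra d S"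
| mult: "A \<in> generated_algebra d S \<Longrightarrow> B \<in> generated_algebra d S \<Longrightarrow> A * B \<in> generated_algebra d S"

section \<open>Qubits and Majorana operators\<close>

text \<open>Operators on \<open>n\<close> qubits are \<open>2 ^ n \<times> 2 ^ n\<close> matrices in the computational basis; qubit \<open>1\<close>
  is the leftmost tensor factor, i.e. the most significant bit of a basis index.\<close>

definition pauli_x :: "complex mat" where
  "pauli_x = mat_of_rows_list 2 [[0, 1], [1, 0]]"

definition pauli_y :: "complex mat" where
  "pauli_y = mat_of_rows_list 2 [[0, - \<i>], [\<i>, 0]]"

definition pauli_z :: "complex mat" where
  "pauli_z = mat_of_rows_list 2 [[1, 0], [0, - 1]]"

text \<open>The one-qubit operator \<open>P\<close> acting on qubit \<open>k \<in> {1..n}\<close>.\<close>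

definition on_qubit :: "nat \<Rightarrow> nat \<Rightarrow> complex mat \<Rightarrow> complex mat" where
  "on_qubit n k P = kron_mat (kron_mat (1\<^sub>m (2 ^ (k - 1))) P) (1\<^sub>m (2 ^ (n - k)))"

text \<open>\<open>Z\<^sub>1 \<cdots> Z\<^sub>k\<^sub>-\<^sub>1\<close>\<close>

definition z_string :: "nat \<Rightarrow> nat \<Rightarrow> complex mat" where
  "z_string n k = foldr (\<lambda>j M. on_qubit n j pauli_z * M) [1..<k] (1\<^sub>m (2 ^ n))"

text \<open>Indices range over \<open>{1..2 * n}\<close>; both \<open>2 * k - 1\<close> and \<open>2 * k\<close> belong to qubit \<open>k\<close>.\<close>

definition majorana :: "nat \<Rightarrow> nat \<Rightarrow> complex mat" where
  "majorana n \<mu> = (let k = (\<mu> + 1) div 2 in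
     z_string n k * on_qubit n k (if odd \<mu> then pauli_x else pauli_y))"

text \<open>\<open>|0\<^sup>n\<rangle>\<close>\<close>

definition zero_state :: "nat \<Rightarrow> complex vec" where
  "zero_state n = unit_vec (2 ^ n) 0"

definition pure_state :: "nat \<Rightarrow> complex vec \<Rightarrow> bool" where
  "pure_state n \<psi> \<longleftrightarrow> \<psi> \<in> carrier_vec (2 ^ n) \<and> \<psi> \<bullet>c \<psi> = 1"

section \<open>Doped and compressible Gaussian states\<close>

text \<open>Matrix entries are indexed from \<open>0\<close>, Majorana operators from \<open>1\<close>.\<close>

definition gaussian_unitary :: "nat \<Rightarrow> complex mat \<Rightarrow> bool" where
  "gaussian_unitary n G \<longleftrightarrow> unitary_mat (2 ^ n) G \<and>
     (\<exists>Q \<in> orthogonal_group (2 * n). \<forall>\<mu> \<in> {1..2 * n}.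
        mat_adjoint G * majorana n \<mu> * G =
        mat_sum (2 ^ n) (\<lambda>\<nu>. complex_of_real (Q $$ (\<mu> - 1, \<nu> - 1)) \<cdot>\<^sub>m majorana n \<nu>) {1..2 * n})"

definition local_gate :: "nat \<Rightarrow> nat \<Rightarrow> complex mat \<Rightarrow> bool" where
  "local_gate n \<kappa> W \<longleftrightarrow> (\<exists>M H. M \<subseteq> {1..2 * n} \<and> card M \<le> \<kappa> \<and>
     hermitian_mat (2 ^ n) H \<and> H \<in> generated_algebra (2 ^ n) (majorana n ` M) \<and>
     W = mat_exp (\<i> \<cdot>\<^sub>m H))"

text \<open>\<open>G\<^sub>t W\<^sub>t \<cdots> G\<^sub>1 W\<^sub>1 G\<^sub>0\<close>\<close>

fun doped_circuit :: "(nat \<Rightarrow> complex mat) \<Rightarrow> (nat \<Rightarrow> complex mat) \<Rightarrow> nat \<Rightarrow> complex mat" where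
  "doped_circuit G W 0 = G 0"
| "doped_circuit G W (Suc t) = G (Suc t) * W (Suc t) * doped_circuit G W t"

definition doped_gaussian_state :: "nat \<Rightarrow> nat \<Rightarrow> nat \<Rightarrow> complex vec \<Rightarrow> bool" where
  "doped_gaussian_state n t \<kappa> \<psi> \<longleftrightarrow> pure_state n \<psi> \<and>
     (\<exists>G W. (\<forall>i \<in> {0..t}. gaussian_unitary n (G i)) \<and> (\<forall>i \<in> {1..t}. local_gate n \<kappa> (W i)) \<and>
        \<psi> = doped_circuit G W t *\<^sub>v zero_state n)"

definition gaussian_compressible :: "nat \<Rightarrow> nat \<Rightarrow> complex vec \<Rightarrow> bool" where
  "gaussian_compressible n s \<psi> \<longleftrightarrow> s \<in> {1..n} \<and> pure_state n \<psi> \<and>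
     (\<exists>G \<phi>. gaussian_unitary n G \<and> pure_state s \<phi> \<and>
        \<psi> = G *\<^sub>v kron_vec \<phi> (zero_state (n - s)))"

end

theory Submission
  imports Defs
begin

text \<open>For a state \<open>\<psi>\<close> consider the complex vectors \<open>w\<close> with \<open>(\<Sum>\<nu>. w\<^sub>\<nu> \<gamma>\<^sub>\<nu>) \<psi> = 0\<close>.  They form
  an \<open>n\<close>-dimensional space for \<open>|0\<^sup>n\<rangle>\<close>; a Gaussian unitary transports this space by an orthogonal
  matrix, and a gate generated by \<open>\<gamma>\<^sub>\<mu>\<close>, \<open>\<mu> \<in> M\<close>, keeps every \<open>w\<close> vanishing on \<open>M\<close>, so it lowers
  the dimension by at most \<open>|M| \<le> \<kappa>\<close>.  A doped state thus retains an annihilator of dimension at least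
  \<open>n - \<kappa> t\<close>, which by the Clifford relations is isotropic: the real and imaginary parts of its elements
  are orthogonal and of equal length.  The operators \<open>\<Sum>\<nu>. v\<^sub>\<nu> \<gamma>\<^sub>\<nu>\<close> with \<open>v\<close> a real unit vector are Gaussian
  and act as Householder reflections up to sign, so products of them turn \<open>n - \<kappa> t\<close> annihilating
  vectors into the annihilation operators of the last \<open>n - \<kappa> t\<close> qubits.  A state killed by these is
  \<open>|\<phi>\<rangle> \<otimes> |0\<^bsup>n - \<kappa> t\<^esup>\<rangle>\<close>.\<close>

text \<open>The obstacle is to clear a mode without spoiling the modes already cleared. Suppose
  \<open>lowering j\<close> annihilates the state for all j > k. A further annihilating vector w is
  chosen with zero bilinear product against the conjugates of these vectors; isotropy gives zero
  product against the vectors themselves. Together this makes w vanish on every coordinate of the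
  modes j > k, and two reflections built from the real and imaginary parts of w then fix these
  coordinates. Finding such a w imposes n - k linear conditions, just as avoiding M imposes |M| of
  them. Hence dimension is measured by how many linear functionals can be killed at once: each step
  only counts conditions, and no bases or subspaces have to be carried along. The Clifford relations
  are proved by induction on the number of qubits. A new qubit is the last tensor factor, so an old
  Majorana operator becomes itself tensor the identity, while the two new ones are the parity
  operator tensor X or Y.\<close>

section \<open>Kronecker products and adjoints\<close>

lemma sum_lessThan_mult:
  fixes f :: "nat \<Rightarrow> 'a::comm_monoid_add"
  shows "(\<Sum>k<b * q. f k) = (\<Sum>x<b. \<Sum>y<q. f (x * q + y))"
proof -
  have "(\<Sum>k<b * q. f k) = (\<Sum>x<b. sum f {x * q..<x * q + q})"
    by (rule sum.nat_group [symmetric])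
  also have "\<dots> = (\<Sum>x<b. \<Sum>y<q. f (x * q + y))"
    by (rule sum.cong [OF refl], subst sum.atLeastLessThan_shift_0)
      (simp add: comp_def lessThan_atLeast0)
  finally show ?thesis .
qed

lemma index_mult_mat_sum:
  assumes "A \<in> carrier_mat a b" "B \<in> carrier_mat b c" "i < a" "j < c"
  shows "(A * B) $$ (i, j) = (\<Sum>k<b. A $$ (i, k) * B $$ (k, j))"
  using assms by (simp add: scalar_prod_def lessThan_atLeast0)

lemma kron_mat_carrier [simp]:
  assumes "A \<in> carrier_mat a b" "B \<in> carrier_mat c d"
  shows "kron_mat A B \<in> carrier_mat (a * c) (b * d)"
  using assms by (simp add: kron_mat_def)

lemma index_kron_mat:
  assumes "A \<in> carrier_mat a b" "B \<in> carrier_mat c d" "i < a * c" "j < b * d"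
  shows "kron_mat A B $$ (i, j) = A $$ (i div c, j div d) * B $$ (i mod c, j mod d)"
  using assms by (simp add: kron_mat_def)

lemma div_mod_less:
  assumes "i < a * (b :: nat)"
  shows "i div b < a" "i mod b < b"
proof -
  show "i div b < a" using assms by (rule less_mult_imp_div_less)
  show "i mod b < b" using assms by (cases b) auto
qed

text \<open>The mixed-product rule: with the inner index written as x * q + y, the sum becomes a
  double sum that factors. All later operator identities are checked one tensor factor at a time
  through it.\<close>

lemma kron_mat_mult:
  assumes A: "A \<in> carrier_mat a b" and C: "C \<in> carrier_mat b c"
    and B: "B \<in> carrier_mat p q" and D: "D \<in> carrier_mat q r"
  shows "kron_mat A B * kron_mat C D = kron_mat (A * C) (B * D)"
proof (rule eq_matI)
  have AB: "kron_mat A B \<in> carrier_mat (a * p) (b * q)" using A B by simp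
  have CD: "kron_mat C D \<in> carrier_mat (b * q) (c * r)" using C D by simp
  have AC: "A * C \<in> carrier_mat a c" and BD: "B * D \<in> carrier_mat p r" using A B C D by auto
  have K: "kron_mat (A * C) (B * D) \<in> carrier_mat (a * p) (c * r)" using AC BD by simp
  fix i j assume "i < dim_row (kron_mat (A * C) (B * D))" "j < dim_col (kron_mat (A * C) (B * D))"
  then have i: "i < a * p" and j: "j < c * r" using K by auto
  note ib = div_mod_less [OF i] and jb = div_mod_less [OF j]
  have "(kron_mat A B * kron_mat C D) $$ (i, j)
      = (\<Sum>k<b * q. kron_mat A B $$ (i, k) * kron_mat C D $$ (k, j))"
    by (rule index_mult_mat_sum [OF AB CD i j])
  also have "\<dots> = (\<Sum>x<b. \<Sum>y<q. kron_mat A B $$ (i, x * q + y) * kron_mat C D $$ (x * q + y, j))"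
    by (rule sum_lessThan_mult)
  also have "\<dots> = (\<Sum>x<b. \<Sum>y<q. (A $$ (i div p, x) * C $$ (x, j div r)) *
      (B $$ (i mod p, y) * D $$ (y, j mod r)))"
  proof (intro sum.cong refl)
    fix x y assume "x \<in> {..<b}" "y \<in> {..<q}"
    then have x: "x < b" and y: "y < q" by auto
    have xy: "x * q + y < b * q"
    proof -
      have "x * q + y < Suc x * q" using y by simp
      also have "\<dots> \<le> b * q" using x by (intro mult_right_mono) auto
      finally show ?thesis .
    qed
    show "kron_mat A B $$ (i, x * q + y) * kron_mat C D $$ (x * q + y, j) =
       (A $$ (i div p, x) * C $$ (x, j div r)) * (B $$ (i mod p, y) * D $$ (y, j mod r))"
      using y by (simp add: index_kron_mat [OF A B i xy] index_kron_mat [OF C D xy j])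
  qed
  also have "\<dots> = (A * C) $$ (i div p, j div r) * (B * D) $$ (i mod p, j mod r)"
    by (simp add: index_mult_mat_sum [OF A C ib(1) jb(1)] index_mult_mat_sum [OF B D ib(2) jb(2)]
        sum_product)
  also have "\<dots> = kron_mat (A * C) (B * D) $$ (i, j)"
    by (simp add: index_kron_mat [OF AC BD i j])
  finally show "(kron_mat A B * kron_mat C D) $$ (i, j) = kron_mat (A * C) (B * D) $$ (i, j)" .
qed (use A B C D in \<open>auto simp: kron_mat_def\<close>)

lemma kron_mat_assoc: "kron_mat (kron_mat A B) C = kron_mat A (kron_mat B C)"
proof (rule eq_matI)
  fix i j assume "i < dim_row (kron_mat A (kron_mat B C))" "j < dim_col (kron_mat A (kron_mat B C))"
  then have i: "i < dim_row A * (dim_row B * dim_row C)" and j: "j < dim_col A * (dim_col B * dim_col C)"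
    by (auto simp: kron_mat_def)
  \<comment> \<open>Both bracketings read the same three mixed-radix digits of an index.\<close>
  have split: "k div (b * c) = k div c div b" "k mod (b * c) div c = k div c mod b"
    "k mod (b * c) mod c = k mod c" if "k < a * (b * c)" for k a b c :: nat
  proof -
    have "c > 0" using that by (cases c) auto
    then show "k mod (b * c) div c = k div c mod b"
      by (simp add: mult.commute [of b c] mod_mult2_eq)
    show "k mod (b * c) mod c = k mod c" by (simp add: mod_mod_cancel)
    show "k div (b * c) = k div c div b" by (simp add: mult.commute [of b c] div_mult2_eq)
  qed
  have i': "i < dim_row A * dim_row B * dim_row C" and j': "j < dim_col A * dim_col B * dim_col C"
    using i j by (simp_all add: mult.assoc)
  show "kron_mat (kron_mat A B) C $$ (i, j) = kron_mat A (kron_mat B C) $$ (i, j)"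
    using i j i' j' div_mod_less [OF i] div_mod_less [OF j] div_mod_less [OF i'] div_mod_less [OF j']
    by (simp add: kron_mat_def split [OF i] split [OF j])
qed (auto simp: kron_mat_def)

lemma kron_mat_one: "kron_mat (1\<^sub>m a) (1\<^sub>m b) = 1\<^sub>m (a * b)"
proof (rule eq_matI)
  fix i j assume "i < dim_row (1\<^sub>m (a * b) :: complex mat)" "j < dim_col (1\<^sub>m (a * b) :: complex mat)"
  then have i: "i < a * b" and j: "j < a * b" by auto
  have "i = j \<longleftrightarrow> i div b = j div b \<and> i mod b = j mod b"
    by (metis div_mult_mod_eq)
  then show "kron_mat (1\<^sub>m a) (1\<^sub>m b) $$ (i, j) = 1\<^sub>m (a * b) $$ (i, j)"
    using i j div_mod_less [OF i] div_mod_less [OF j] by (auto simp: kron_mat_def)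
qed (auto simp: kron_mat_def)

lemma kron_mat_one_right: "kron_mat A (1\<^sub>m 1) = A"
  by (rule eq_matI) (auto simp: kron_mat_def)

lemma kron_mat_smult_left: "kron_mat (c \<cdot>\<^sub>m A) B = c \<cdot>\<^sub>m kron_mat A B"
  by (rule eq_matI) (auto simp: kron_mat_def div_mod_less)

lemma kron_mat_smult_right: "kron_mat A (c \<cdot>\<^sub>m B) = c \<cdot>\<^sub>m kron_mat A B"
  by (rule eq_matI) (auto simp: kron_mat_def div_mod_less)

lemma dim_mat_adjoint [simp]:
  "dim_row (mat_adjoint A) = dim_col A" "dim_col (mat_adjoint A) = dim_row A"
  by (auto simp: mat_adjoint_def)

lemma mat_adjoint_carrier [simp]: "A \<in> carrier_mat a b \<Longrightarrow> mat_adjoint A \<in> carrier_mat b a"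
  by auto

lemma index_mat_adjoint:
  "i < dim_col A \<Longrightarrow> j < dim_row A \<Longrightarrow> mat_adjoint A $$ (i, j) = conjugate (A $$ (j, i))"
  by (simp add: mat_adjoint_def mat_of_rows_def)

lemma mat_adjoint_kron: "mat_adjoint (kron_mat A B) = kron_mat (mat_adjoint A) (mat_adjoint B)"
  by (rule eq_matI) (auto simp: kron_mat_def index_mat_adjoint div_mod_less)

lemma mat_adjoint_one [simp]: "mat_adjoint (1\<^sub>m d :: complex mat) = 1\<^sub>m d"
  by (rule eq_matI) (auto simp: index_mat_adjoint)

lemma mat_adjoint_mult:
  fixes A B :: "complex mat"
  assumes A: "A \<in> carrier_mat a b" and B: "B \<in> carrier_mat b c"
  shows "mat_adjoint (A * B) = mat_adjoint B * mat_adjoint A"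
proof (rule eq_matI)
  fix i j assume "i < dim_row (mat_adjoint B * mat_adjoint A)" "j < dim_col (mat_adjoint B * mat_adjoint A)"
  then have i: "i < c" and j: "j < a" using A B by auto
  show "mat_adjoint (A * B) $$ (i, j) = (mat_adjoint B * mat_adjoint A) $$ (i, j)"
    using A B i j
    by (simp add: index_mat_adjoint index_mult_mat_sum [OF A B j i]
        index_mult_mat_sum [OF mat_adjoint_carrier [OF B] mat_adjoint_carrier [OF A] i j] mult.commute)
qed (use A B in auto)

section \<open>The Clifford relations\<close>

lemma pauli_carrier [simp]:
  "pauli_x \<in> carrier_mat 2 2" "pauli_y \<in> carrier_mat 2 2" "pauli_z \<in> carrier_mat 2 2"
  by (auto simp: pauli_x_def pauli_y_def pauli_z_def mat_of_rows_list_def)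

lemma dim_pauli [simp]:
  "dim_row pauli_x = 2" "dim_col pauli_x = 2" "dim_row pauli_y = 2" "dim_col pauli_y = 2"
  "dim_row pauli_z = 2" "dim_col pauli_z = 2"
  by (auto simp: pauli_x_def pauli_y_def pauli_z_def mat_of_rows_list_def)

lemma mat_2_eqI:
  assumes "dim_row A = 2" "dim_col A = 2" "dim_row B = 2" "dim_col B = 2"
    "A $$ (0, 0) = B $$ (0, 0)" "A $$ (0, 1) = B $$ (0, 1)"
    "A $$ (1, 0) = B $$ (1, 0)" "A $$ (1, 1) = B $$ (1, 1)"
  shows "A = B"
  by (rule eq_matI) (use assms in \<open>auto simp: less_2_cases_iff\<close>)

lemma pauli_index:
  "pauli_x $$ (0, 0) = 0" "pauli_x $$ (0, Suc 0) = 1" "pauli_x $$ (Suc 0, 0) = 1" "pauli_x $$ (Suc 0, Suc 0) = 0"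
  "pauli_y $$ (0, 0) = 0" "pauli_y $$ (0, Suc 0) = - \<i>" "pauli_y $$ (Suc 0, 0) = \<i>" "pauli_y $$ (Suc 0, Suc 0) = 0"
  "pauli_z $$ (0, 0) = 1" "pauli_z $$ (0, Suc 0) = 0" "pauli_z $$ (Suc 0, 0) = 0" "pauli_z $$ (Suc 0, Suc 0) = - 1"
  by (auto simp: pauli_x_def pauli_y_def pauli_z_def mat_of_rows_list_def)

lemma index_mult_mat_2:
  assumes "A \<in> carrier_mat 2 2" "B \<in> carrier_mat 2 2" "i < 2" "j < 2"
  shows "(A * B) $$ (i, j) = A $$ (i, 0) * B $$ (0, j) + A $$ (i, Suc 0) * B $$ (Suc 0, j)"
  by (simp add: index_mult_mat_sum [OF assms] numeral_2_eq_2)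

lemma pauli_relations:
  "pauli_x * pauli_x = 1\<^sub>m 2" "pauli_y * pauli_y = 1\<^sub>m 2" "pauli_z * pauli_z = 1\<^sub>m 2"
  "pauli_x * pauli_y = (- 1) \<cdot>\<^sub>m (pauli_y * pauli_x)"
  "pauli_y * pauli_x = (- 1) \<cdot>\<^sub>m (pauli_x * pauli_y)"
  "pauli_z * pauli_x = (- 1) \<cdot>\<^sub>m (pauli_x * pauli_z)"
  "pauli_z * pauli_y = (- 1) \<cdot>\<^sub>m (pauli_y * pauli_z)"
  "mat_adjoint pauli_x = pauli_x" "mat_adjoint pauli_y = pauli_y" "mat_adjoint pauli_z = pauli_z"
  by - (rule mat_2_eqI;
      simp add: index_mult_mat_2 pauli_index index_mat_adjoint del: index_mult_mat(1))+

lemma on_qubit_carrier [simp]: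
  assumes "P \<in> carrier_mat 2 2" "k \<in> {1..n}"
  shows "on_qubit n k P \<in> carrier_mat (2 ^ n) (2 ^ n)"
proof -
  have "2 ^ (k - 1) * 2 * 2 ^ (n - k) = (2 :: nat) ^ n"
    using assms(2) by (simp flip: power_add power_Suc2)
  then show ?thesis
    unfolding on_qubit_def by (metis assms(1) kron_mat_carrier one_carrier_mat)
qed

lemma on_qubit_Suc:
  assumes "k \<le> n"
  shows "on_qubit (Suc n) k P = kron_mat (on_qubit n k P) (1\<^sub>m 2)"
  using assms kron_mat_one [of "2 ^ (n - k)" 2]
  by (simp add: on_qubit_def kron_mat_assoc Suc_diff_le mult.commute)

lemma on_qubit_last: "on_qubit (Suc n) (Suc n) P = kron_mat (1\<^sub>m (2 ^ n)) P"
  using kron_mat_one_right by (simp add: on_qubit_def)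

lemma z_product_carrier:
  assumes "set xs \<subseteq> {1..n}"
  shows "foldr (\<lambda>j M. on_qubit n j pauli_z * M) xs (1\<^sub>m (2 ^ n)) \<in> carrier_mat (2 ^ n) (2 ^ n)"
  using assms
proof (induction xs)
  case (Cons a xs)
  then show ?case
    by (simp add: mult_carrier_mat [OF on_qubit_carrier [OF pauli_carrier(3)]])
qed simp

text \<open>Lets a factor be appended at the right end of a Z string: a fold started from
  \<open>X\<close> is the plain string times \<open>X\<close>.\<close>

lemma z_product_mult:
  assumes "set xs \<subseteq> {1..n}" "X \<in> carrier_mat (2 ^ n) (2 ^ n)"
  shows "foldr (\<lambda>j M. on_qubit n j pauli_z * M) xs X =
    foldr (\<lambda>j M. on_qubit n j pauli_z * M) xs (1\<^sub>m (2 ^ n)) * X"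
  using assms
proof (induction xs)
  case (Cons a xs)
  then have a: "on_qubit n a pauli_z \<in> carrier_mat (2 ^ n) (2 ^ n)" by simp
  show ?case
    using Cons assoc_mult_mat [OF a z_product_carrier [of xs n] assms(2)] by simp
qed simp

lemma z_product_Suc:
  assumes "set xs \<subseteq> {1..n}"
  shows "foldr (\<lambda>j M. on_qubit (Suc n) j pauli_z * M) xs (1\<^sub>m (2 ^ Suc n)) =
    kron_mat (foldr (\<lambda>j M. on_qubit n j pauli_z * M) xs (1\<^sub>m (2 ^ n))) (1\<^sub>m 2)"
  using assms
proof (induction xs)
  case Nil
  then show ?case by (simp add: kron_mat_one mult.commute [of "2 ^ n" 2])
next
  case (Cons a xs)
  then have a: "on_qubit n a pauli_z \<in> carrier_mat (2 ^ n) (2 ^ n)" by simp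
  show ?case
    using Cons kron_mat_mult [OF a z_product_carrier [of xs n] one_carrier_mat [of 2] one_carrier_mat [of 2]]
    by (simp add: on_qubit_Suc)
qed

lemma z_string_carrier:
  "k \<le> Suc n \<Longrightarrow> z_string n k \<in> carrier_mat (2 ^ n) (2 ^ n)"
  unfolding z_string_def by (rule z_product_carrier) auto

lemma z_string_Suc: "k \<le> Suc n \<Longrightarrow> z_string (Suc n) k = kron_mat (z_string n k) (1\<^sub>m 2)"
  unfolding z_string_def by (rule z_product_Suc) auto

lemma dim_z_string [simp]:
  assumes "k \<le> Suc n"
  shows "dim_row (z_string n k) = 2 ^ n" "dim_col (z_string n k) = 2 ^ n"
  using z_string_carrier [OF assms] by auto

lemma dim_on_qubit [simp]:
  assumes "P \<in> carrier_mat 2 2" "k \<in> {1..n}"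
  shows "dim_row (on_qubit n k P) = 2 ^ n" "dim_col (on_qubit n k P) = 2 ^ n"
  using on_qubit_carrier [OF assms] by auto

section \<open>The parity operator and the recursion of the Majorana operators in n\<close>

text \<open>The product of Z over all qubits: \<open>z_string n k\<close> stops before qubit k, so
  the argument \<open>Suc n\<close> takes in every one. It is the left tensor factor of the two
  newest Majorana operators and also the operator that anticommutes with all Majorana
  operators.\<close>

definition parity_op :: "nat \<Rightarrow> complex mat" where
  "parity_op n = z_string n (Suc n)"

lemma parity_carrier [simp]: "parity_op n \<in> carrier_mat (2 ^ n) (2 ^ n)"
  by (simp add: parity_op_def z_string_carrier)

text \<open>The mixed-product rule with carriers replaced by dimension equations, a form the
  simplifier can discharge in the inductions on n.\<close>

lemma kron_mat_mult_dim:
  assumes "dim_col A = dim_row C" "dim_col B = dim_row D"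
  shows "kron_mat A B * kron_mat C D = kron_mat (A * C) (B * D)"
  by (rule kron_mat_mult [where b = "dim_row C" and q = "dim_row D"]) (use assms in auto)

lemma dim_parity [simp]: "dim_row (parity_op n) = 2 ^ n" "dim_col (parity_op n) = 2 ^ n"
  by (rule carrier_matD [OF parity_carrier])+

lemma parity_0: "parity_op 0 = 1\<^sub>m (Suc 0)"
  by (simp add: parity_op_def z_string_def)

lemma parity_Suc: "parity_op (Suc n) = kron_mat (parity_op n) pauli_z"
proof -
  have "parity_op (Suc n) = foldr (\<lambda>j M. on_qubit (Suc n) j pauli_z * M) [1..<Suc n]
      (on_qubit (Suc n) (Suc n) pauli_z * 1\<^sub>m (2 ^ Suc n))"
    unfolding parity_op_def z_string_def by simp
  also have "\<dots> = z_string (Suc n) (Suc n) * on_qubit (Suc n) (Suc n) pauli_z"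
    unfolding z_string_def
    by (subst right_mult_one_mat [OF on_qubit_carrier [OF pauli_carrier(3)]], simp, subst z_product_mult) auto
  also have "\<dots> = kron_mat (parity_op n) pauli_z"
    by (simp add: z_string_Suc on_qubit_last kron_mat_mult_dim z_string_carrier parity_op_def
        right_mult_one_mat [OF z_string_carrier])
  finally show ?thesis .
qed

lemma parity_square: "parity_op n * parity_op n = 1\<^sub>m (2 ^ n)"
proof (induction n)
  case (Suc n)
  then show ?case
    by (simp add: parity_Suc kron_mat_mult_dim pauli_relations kron_mat_one mult.commute [of "2 ^ n" 2])
qed (simp add: parity_0)

lemma parity_adjoint: "mat_adjoint (parity_op n) = parity_op n"
  by (induction n) (simp_all add: parity_0 parity_Suc mat_adjoint_kron pauli_relations)

lemma majorana_carrier [simp]: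
  assumes "\<mu> \<in> {1..2 * n}"
  shows "majorana n \<mu> \<in> carrier_mat (2 ^ n) (2 ^ n)"
proof -
  have "(\<mu> + 1) div 2 \<in> {1..n}" using assms by auto
  then show ?thesis
    unfolding majorana_def Let_def
    by (intro mult_carrier_mat [where n = "2 ^ n"] z_string_carrier on_qubit_carrier) auto
qed

lemma dim_majorana [simp]:
  assumes "\<mu> \<in> {1..2 * n}"
  shows "dim_row (majorana n \<mu>) = 2 ^ n" "dim_col (majorana n \<mu>) = 2 ^ n"
  using majorana_carrier [OF assms] by auto

text \<open>The string of an old Majorana operator never reaches qubit n + 1, so the new last factor
  is the identity. With the two lemmas on the new operators this makes every relation provable by
  induction on n.\<close>

lemma majorana_Suc:
  assumes "\<mu> \<in> {1..2 * n}"
  shows "majorana (Suc n) \<mu> = kron_mat (majorana n \<mu>) (1\<^sub>m 2)"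
proof -
  have k: "(\<mu> + 1) div 2 \<in> {1..n}" using assms by auto
  have *: "kron_mat (z_string n k) (1\<^sub>m 2) * kron_mat (on_qubit n k P) (1\<^sub>m 2) =
     kron_mat (z_string n k * on_qubit n k P) (1\<^sub>m 2)"
    if "k \<in> {1..n}" "P \<in> carrier_mat 2 2" for k P
    using that by (subst kron_mat_mult_dim) (auto simp: z_string_carrier)
  show ?thesis
    unfolding majorana_def Let_def using k
    by (subst * [symmetric]) (auto simp: z_string_Suc on_qubit_Suc)
qed

lemma majorana_last_odd: "majorana (Suc n) (Suc (2 * n)) = kron_mat (parity_op n) pauli_x"
  by (simp add: majorana_def z_string_Suc on_qubit_last kron_mat_mult_dim z_string_carrier parity_op_def
        right_mult_one_mat [OF z_string_carrier])

lemma majorana_last_even: "majorana (Suc n) (Suc (Suc (2 * n))) = kron_mat (parity_op n) pauli_y"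
proof -
  have "(Suc (Suc (2 * n)) + 1) div 2 = Suc n" by simp
  then show ?thesis
    unfolding majorana_def Let_def
    by (simp add: z_string_Suc on_qubit_last kron_mat_mult_dim z_string_carrier parity_op_def
        right_mult_one_mat [OF z_string_carrier])
qed

lemma majorana_Suc_cases [consumes 1, case_names old odd even]:
  assumes "\<mu> \<in> {1..2 * Suc n}"
  obtains "\<mu> \<in> {1..2 * n}" | "\<mu> = Suc (2 * n)" | "\<mu> = Suc (Suc (2 * n))"
  using assms by force

lemma majorana_adjoint:
  assumes "\<mu> \<in> {1..2 * n}"
  shows "mat_adjoint (majorana n \<mu>) = majorana n \<mu>"
  using assms
proof (induction n)
  case (Suc n)
  from Suc.prems show ?case
    by (cases rule: majorana_Suc_cases)
      (simp_all add: majorana_Suc majorana_last_odd majorana_last_even mat_adjoint_kron Suc.IH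
        parity_adjoint pauli_relations)
qed simp

lemma majorana_square:
  assumes "\<mu> \<in> {1..2 * n}"
  shows "majorana n \<mu> * majorana n \<mu> = 1\<^sub>m (2 ^ n)"
  using assms
proof (induction n)
  case (Suc n)
  from Suc.prems show ?case
    by (cases rule: majorana_Suc_cases)
      (simp_all add: majorana_Suc majorana_last_odd majorana_last_even kron_mat_mult_dim Suc.IH
        parity_square pauli_relations kron_mat_one mult.commute [of "2 ^ n" 2])
qed simp

lemma smult_minus_one_twice: "(- 1 :: complex) \<cdot>\<^sub>m ((- 1) \<cdot>\<^sub>m A) = A"
  by (rule eq_matI) auto

text \<open>On old indices the sign comes from the first n qubits by induction; on the two new ones
  it comes from Z against X or Y on the last qubit.\<close>

lemma parity_majorana:
  assumes "\<mu> \<in> {1..2 * n}"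
  shows "parity_op n * majorana n \<mu> = (- 1) \<cdot>\<^sub>m (majorana n \<mu> * parity_op n)"
  using assms
proof (induction n)
  case (Suc n)
  from Suc.prems show ?case
    by (cases rule: majorana_Suc_cases)
      (simp_all add: majorana_Suc majorana_last_odd majorana_last_even parity_Suc kron_mat_mult_dim Suc.IH
        pauli_relations(6,7) kron_mat_smult_left kron_mat_smult_right)
qed simp

text \<open>Two old operators use the induction hypothesis, an old and a new one use
  \<open>parity_majorana\<close> on the first n qubits, and the two new ones use X against Y on the
  last qubit. When the old operator stands on the left, the parity rule rewrites the right-hand side
  instead, and the two signs cancel by \<open>smult_minus_one_twice\<close>.\<close>

lemma majorana_anticommute:
  assumes "\<mu> \<in> {1..2 * n}" "\<nu> \<in> {1..2 * n}" "\<mu> \<noteq> \<nu>"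
  shows "majorana n \<mu> * majorana n \<nu> = (- 1) \<cdot>\<^sub>m (majorana n \<nu> * majorana n \<mu>)"
  using assms
proof (induction n)
  case (Suc n)
  note simps = majorana_Suc majorana_last_odd majorana_last_even kron_mat_mult_dim Suc.IH
    parity_majorana kron_mat_smult_left kron_mat_smult_right smult_minus_one_twice
  from Suc.prems(1) show ?case
  proof (cases rule: majorana_Suc_cases)
    case old
    from Suc.prems(2) show ?thesis
      by (cases rule: majorana_Suc_cases) (use old Suc.prems(3) in \<open>simp_all add: simps\<close>)
  next
    case odd
    from Suc.prems(2) show ?thesis
      by (cases rule: majorana_Suc_cases)
        (use odd Suc.prems(3) in \<open>simp_all add: simps pauli_relations(4)\<close>)
  next
    case even
    from Suc.prems(2) show ?thesis
      by (cases rule: majorana_Suc_cases)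
        (use even Suc.prems(3) in \<open>simp_all add: simps pauli_relations(5)\<close>)
  qed
qed simp

section \<open>Matrix exponentials\<close>

text \<open>The sum of the norms of all entries dominates every column sum, so entries of powers
  grow at most geometrically. This yields the scalar exponential series as a majorant for
  \<open>mat_exp\<close>.\<close>

lemma pow_mat_entry_bound:
  fixes A :: "complex mat"
  assumes A: "A \<in> carrier_mat d d" and "i < d" "j < d"
  shows "norm ((A ^\<^sub>m m) $$ (i, j)) \<le> (\<Sum>i<d. \<Sum>j<d. norm (A $$ (i, j))) ^ m"
  using assms(2,3)
proof (induction m arbitrary: i j)
  case 0
  then show ?case using A by auto
next
  case (Suc m)
  let ?c = "\<Sum>i<d. \<Sum>j<d. norm (A $$ (i, j))"
  have "norm ((A ^\<^sub>m Suc m) $$ (i, j)) = norm (\<Sum>k<d. (A ^\<^sub>m m) $$ (i, k) * A $$ (k, j))"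
    using index_mult_mat_sum [OF pow_carrier_mat [OF A] A Suc.prems] by simp
  also have "\<dots> \<le> (\<Sum>k<d. ?c ^ m * norm (A $$ (k, j)))"
    by (rule sum_norm_le) (use Suc in \<open>auto simp: norm_mult intro!: mult_right_mono\<close>)
  also have "\<dots> = ?c ^ m * (\<Sum>k<d. norm (A $$ (k, j)))"
    by (simp add: sum_distrib_left)
  also have "\<dots> \<le> ?c ^ m * ?c"
    using Suc.prems(2)
    by (intro mult_left_mono sum_mono zero_le_power sum_nonneg)
      (auto intro: member_le_sum)
  finally show ?case by (simp add: mult.commute)
qed

lemma summable_mat_exp:
  fixes A :: "complex mat"
  assumes "A \<in> carrier_mat d d" "i < d" "j < d"
  shows "summable (\<lambda>m. (A ^\<^sub>m m) $$ (i, j) / fact m)"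
proof (rule summable_comparison_test')
  let ?c = "\<Sum>i<d. \<Sum>j<d. norm (A $$ (i, j))"
  show "summable (\<lambda>m. inverse (fact m) * ?c ^ m)" by (rule summable_exp)
  show "norm ((A ^\<^sub>m m) $$ (i, j) / fact m) \<le> inverse (fact m) * ?c ^ m" for m
    using pow_mat_entry_bound [OF assms, of m] by (simp add: norm_divide field_simps)
qed

lemma pow_mat_commute:
  assumes A: "A \<in> carrier_mat d d" and D: "D \<in> carrier_mat d d" and DA: "D * A = A * D"
  shows "D * A ^\<^sub>m m = A ^\<^sub>m m * D"
proof (induction m)
  case 0
  then show ?case using A D by simp
next
  case (Suc m)
  have P: "A ^\<^sub>m m \<in> carrier_mat d d" using A by simp
  have "D * (A ^\<^sub>m m * A) = A ^\<^sub>m m * D * A"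
    using Suc assoc_mult_mat [OF D P A] by simp
  also have "\<dots> = A ^\<^sub>m m * A * D"
    using assoc_mult_mat [OF P D A] assoc_mult_mat [OF P A D] DA by simp
  finally show ?case by simp
qed

lemma mat_exp_carrier [simp]: "A \<in> carrier_mat d d \<Longrightarrow> mat_exp A \<in> carrier_mat d d"
  by (auto simp: mat_exp_def)

text \<open>\<open>D\<close> commutes with every power of \<open>A\<close>. Passing to the limit is
  an interchange, at each entry, of the finite sum of the matrix product with the convergent
  series.\<close>

lemma mat_exp_commute:
  assumes A: "A \<in> carrier_mat d d" and D: "D \<in> carrier_mat d d" and DA: "D * A = A * D"
  shows "D * mat_exp A = mat_exp A * D"
proof (rule eq_matI)
  fix i j assume "i < dim_row (mat_exp A * D)" "j < dim_col (mat_exp A * D)"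
  then have i: "i < d" and j: "j < d" using A D by (auto simp: mat_exp_def)
  have E: "mat_exp A \<in> carrier_mat d d" using A by simp
  have ex: "mat_exp A $$ (k, l) = (\<Sum>m. (A ^\<^sub>m m) $$ (k, l) / fact m)" if "k < d" "l < d" for k l
    using A that by (simp add: mat_exp_def)
  have "(D * mat_exp A) $$ (i, j) = (\<Sum>k<d. D $$ (i, k) * (\<Sum>m. (A ^\<^sub>m m) $$ (k, j) / fact m))"
    using j by (simp add: index_mult_mat_sum [OF D E i j] ex)
  also have "\<dots> = (\<Sum>k<d. \<Sum>m. D $$ (i, k) * ((A ^\<^sub>m m) $$ (k, j) / fact m))"
    using A j by (intro sum.cong refl suminf_mult [symmetric] summable_mat_exp) auto
  also have "\<dots> = (\<Sum>m. \<Sum>k<d. D $$ (i, k) * ((A ^\<^sub>m m) $$ (k, j) / fact m))"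
    using A j by (intro suminf_sum [symmetric] summable_mult summable_mat_exp) auto
  also have "\<dots> = (\<Sum>m. (D * A ^\<^sub>m m) $$ (i, j) / fact m)"
    by (simp add: index_mult_mat_sum [OF D pow_carrier_mat [OF A] i j] sum_divide_distrib)
  also have "\<dots> = (\<Sum>m. (A ^\<^sub>m m * D) $$ (i, j) / fact m)"
    by (simp add: pow_mat_commute [OF A D DA])
  also have "\<dots> = (\<Sum>m. \<Sum>k<d. (A ^\<^sub>m m) $$ (i, k) / fact m * D $$ (k, j))"
    by (simp add: index_mult_mat_sum [OF pow_carrier_mat [OF A] D i j] sum_divide_distrib)
  also have "\<dots> = (\<Sum>k<d. \<Sum>m. (A ^\<^sub>m m) $$ (i, k) / fact m * D $$ (k, j))"
    using A i by (intro suminf_sum summable_mult2 summable_mat_exp) auto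
  also have "\<dots> = (\<Sum>k<d. (\<Sum>m. (A ^\<^sub>m m) $$ (i, k) / fact m) * D $$ (k, j))"
    using A i by (intro sum.cong refl suminf_mult2 [symmetric] summable_mat_exp) auto
  also have "\<dots> = (mat_exp A * D) $$ (i, j)"
    using i by (simp add: index_mult_mat_sum [OF E D i j] ex)
  finally show "(D * mat_exp A) $$ (i, j) = (mat_exp A * D) $$ (i, j)" .
qed (use A D in \<open>auto simp: mat_exp_def\<close>)

section \<open>Linear combinations of Majorana operators\<close>

lemma mat_sum_carrier [simp]: "mat_sum d f I \<in> carrier_mat d d"
  by (simp add: mat_sum_def)

lemma index_mat_sum: "i < d \<Longrightarrow> j < d \<Longrightarrow> mat_sum d f I $$ (i, j) = (\<Sum>k\<in>I. f k $$ (i, j))"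
  by (simp add: mat_sum_def)

lemma mat_sum_cong: "(\<And>k. k \<in> I \<Longrightarrow> f k = g k) \<Longrightarrow> mat_sum d f I = mat_sum d g I"
  by (simp add: mat_sum_def)

lemma mult_mat_sum:
  assumes A: "A \<in> carrier_mat d d" and f: "\<And>x. x \<in> I \<Longrightarrow> f x \<in> carrier_mat d d"
  shows "A * mat_sum d f I = mat_sum d (\<lambda>x. A * f x) I"
proof (rule eq_matI)
  fix i j assume "i < dim_row (mat_sum d (\<lambda>x. A * f x) I)" "j < dim_col (mat_sum d (\<lambda>x. A * f x) I)"
  then have i: "i < d" and j: "j < d" by (auto simp: mat_sum_def)
  have "(A * mat_sum d f I) $$ (i, j) = (\<Sum>k<d. \<Sum>x\<in>I. A $$ (i, k) * f x $$ (k, j))"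
    using j by (simp add: index_mult_mat_sum [OF A mat_sum_carrier i j] index_mat_sum sum_distrib_left)
  also have "\<dots> = (\<Sum>x\<in>I. \<Sum>k<d. A $$ (i, k) * f x $$ (k, j))" by (rule sum.swap)
  also have "\<dots> = mat_sum d (\<lambda>x. A * f x) I $$ (i, j)"
    using i j by (simp add: index_mat_sum index_mult_mat_sum [OF A f i j])
  finally show "(A * mat_sum d f I) $$ (i, j) = mat_sum d (\<lambda>x. A * f x) I $$ (i, j)" .
qed (use A in \<open>auto simp: mat_sum_def\<close>)

lemma mat_sum_mult:
  assumes A: "A \<in> carrier_mat d d" and f: "\<And>x. x \<in> I \<Longrightarrow> f x \<in> carrier_mat d d"
  shows "mat_sum d f I * A = mat_sum d (\<lambda>x. f x * A) I"
proof (rule eq_matI)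
  fix i j assume "i < dim_row (mat_sum d (\<lambda>x. f x * A) I)" "j < dim_col (mat_sum d (\<lambda>x. f x * A) I)"
  then have i: "i < d" and j: "j < d" by (auto simp: mat_sum_def)
  have "(mat_sum d f I * A) $$ (i, j) = (\<Sum>k<d. \<Sum>x\<in>I. f x $$ (i, k) * A $$ (k, j))"
    using i by (simp add: index_mult_mat_sum [OF mat_sum_carrier A i j] index_mat_sum sum_distrib_right)
  also have "\<dots> = (\<Sum>x\<in>I. \<Sum>k<d. f x $$ (i, k) * A $$ (k, j))" by (rule sum.swap)
  also have "\<dots> = mat_sum d (\<lambda>x. f x * A) I $$ (i, j)"
    using i j by (simp add: index_mat_sum index_mult_mat_sum [OF f A i j])
  finally show "(mat_sum d f I * A) $$ (i, j) = mat_sum d (\<lambda>x. f x * A) I $$ (i, j)" .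
qed (use A in \<open>auto simp: mat_sum_def\<close>)

text \<open>Coefficients are functions on all naturals, of which only the values on {1..2 * n}
  matter. They are complex because annihilation operators are not real combinations.\<close>

definition maj_comb :: "nat \<Rightarrow> (nat \<Rightarrow> complex) \<Rightarrow> complex mat" where
  "maj_comb n w = mat_sum (2 ^ n) (\<lambda>\<nu>. w \<nu> \<cdot>\<^sub>m majorana n \<nu>) {1..2 * n}"

text \<open>The bilinear form without complex conjugation.\<close>

definition dot :: "nat \<Rightarrow> (nat \<Rightarrow> complex) \<Rightarrow> (nat \<Rightarrow> complex) \<Rightarrow> complex" where
  "dot n u w = (\<Sum>\<nu>\<in>{1..2 * n}. u \<nu> * w \<nu>)"

lemma maj_comb_carrier [simp]: "maj_comb n w \<in> carrier_mat (2 ^ n) (2 ^ n)"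
  by (simp add: maj_comb_def)

lemma dim_maj_comb [simp]: "dim_row (maj_comb n w) = 2 ^ n" "dim_col (maj_comb n w) = 2 ^ n"
  by (rule carrier_matD [OF maj_comb_carrier])+

lemma index_maj_comb:
  "i < 2 ^ n \<Longrightarrow> j < 2 ^ n \<Longrightarrow> maj_comb n w $$ (i, j) = (\<Sum>\<nu>\<in>{1..2 * n}. w \<nu> * majorana n \<nu> $$ (i, j))"
  unfolding maj_comb_def by (simp add: index_mat_sum)

lemma maj_comb_cong: "(\<And>\<nu>. \<nu> \<in> {1..2 * n} \<Longrightarrow> u \<nu> = w \<nu>) \<Longrightarrow> maj_comb n u = maj_comb n w"
  unfolding maj_comb_def by (rule mat_sum_cong) simp

lemma maj_comb_add: "maj_comb n (\<lambda>\<nu>. u \<nu> + w \<nu>) = maj_comb n u + maj_comb n w"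
  by (rule eq_matI) (simp_all add: index_maj_comb distrib_right sum.distrib)

lemma maj_comb_smult: "maj_comb n (\<lambda>\<nu>. c * w \<nu>) = c \<cdot>\<^sub>m maj_comb n w"
  by (rule eq_matI) (simp_all add: index_maj_comb sum_distrib_left mult.assoc)

lemma maj_comb_single:
  assumes "\<mu> \<in> {1..2 * n}"
  shows "maj_comb n (\<lambda>\<nu>. if \<nu> = \<mu> then 1 else 0) = majorana n \<mu>"
proof (rule eq_matI)
  fix i j assume "i < dim_row (majorana n \<mu>)" "j < dim_col (majorana n \<mu>)"
  then have "i < 2 ^ n" "j < 2 ^ n" using dim_majorana [OF assms] by auto
  then have "maj_comb n (\<lambda>\<nu>. if \<nu> = \<mu> then 1 else 0) $$ (i, j) =
      (\<Sum>\<nu>\<in>{1..2 * n}. (if \<nu> = \<mu> then 1 else 0) * majorana n \<nu> $$ (i, j))"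
    by (rule index_maj_comb)
  also have "\<dots> = (\<Sum>\<nu>\<in>{1..2 * n}. if \<nu> = \<mu> then majorana n \<nu> $$ (i, j) else 0)"
    by (rule sum.cong) simp_all
  also have "\<dots> = majorana n \<mu> $$ (i, j)"
    using assms by simp
  finally show "maj_comb n (\<lambda>\<nu>. if \<nu> = \<mu> then 1 else 0) $$ (i, j) = majorana n \<mu> $$ (i, j)" .
qed (use dim_majorana [OF assms] in auto)

lemma maj_comb_adjoint: "mat_adjoint (maj_comb n w) = maj_comb n (\<lambda>\<nu>. cnj (w \<nu>))"
proof (rule eq_matI)
  fix i j assume "i < dim_row (maj_comb n (\<lambda>\<nu>. cnj (w \<nu>)))" "j < dim_col (maj_comb n (\<lambda>\<nu>. cnj (w \<nu>)))"
  then have i: "i < 2 ^ n" and j: "j < 2 ^ n" by auto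
  have "cnj (majorana n \<nu> $$ (j, i)) = majorana n \<nu> $$ (i, j)" if "\<nu> \<in> {1..2 * n}" for \<nu>
  proof -
    have "mat_adjoint (majorana n \<nu>) $$ (i, j) = cnj (majorana n \<nu> $$ (j, i))"
      using i j dim_majorana [OF that] by (simp add: index_mat_adjoint)
    then show ?thesis by (simp add: majorana_adjoint [OF that])
  qed
  then show "mat_adjoint (maj_comb n w) $$ (i, j) = maj_comb n (\<lambda>\<nu>. cnj (w \<nu>)) $$ (i, j)"
    using i j by (simp add: index_mat_adjoint index_maj_comb)
qed auto

lemma index_maj_comb_mult:
  assumes i: "i < 2 ^ n" and j: "j < 2 ^ n"
  shows "(maj_comb n u * maj_comb n w) $$ (i, j) =
    (\<Sum>\<mu>\<in>{1..2 * n}. \<Sum>\<nu>\<in>{1..2 * n}. u \<mu> * w \<nu> * (majorana n \<mu> * majorana n \<nu>) $$ (i, j))"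
proof -
  let ?I = "{1..2 * n}"
  have "maj_comb n u * maj_comb n w = mat_sum (2 ^ n) (\<lambda>\<mu>. (u \<mu> \<cdot>\<^sub>m majorana n \<mu>) * maj_comb n w) ?I"
    unfolding maj_comb_def [of n u] by (rule mat_sum_mult) auto
  also have "\<dots> = mat_sum (2 ^ n) (\<lambda>\<mu>. mat_sum (2 ^ n)
      (\<lambda>\<nu>. (u \<mu> \<cdot>\<^sub>m majorana n \<mu>) * (w \<nu> \<cdot>\<^sub>m majorana n \<nu>)) ?I) ?I"
    unfolding maj_comb_def by (intro mat_sum_cong mult_mat_sum) auto
  finally have "(maj_comb n u * maj_comb n w) $$ (i, j) =
      (\<Sum>\<mu>\<in>?I. \<Sum>\<nu>\<in>?I. ((u \<mu> \<cdot>\<^sub>m majorana n \<mu>) * (w \<nu> \<cdot>\<^sub>m majorana n \<nu>)) $$ (i, j))"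
    using i j by (simp add: index_mat_sum)
  also have "\<dots> = (\<Sum>\<mu>\<in>?I. \<Sum>\<nu>\<in>?I. u \<mu> * w \<nu> * (majorana n \<mu> * majorana n \<nu>) $$ (i, j))"
  proof (intro sum.cong refl)
    fix \<mu> \<nu> assume \<mu>: "\<mu> \<in> ?I" and \<nu>: "\<nu> \<in> ?I"
    have "(u \<mu> \<cdot>\<^sub>m majorana n \<mu>) * (w \<nu> \<cdot>\<^sub>m majorana n \<nu>) = u \<mu> \<cdot>\<^sub>m (w \<nu> \<cdot>\<^sub>m (majorana n \<mu> * majorana n \<nu>))"
      using mult_smult_assoc_mat [OF majorana_carrier [OF \<mu>] smult_carrier_mat [OF majorana_carrier [OF \<nu>]]]
        mult_smult_distrib [OF majorana_carrier [OF \<mu>] majorana_carrier [OF \<nu>]] by simp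
    then show "((u \<mu> \<cdot>\<^sub>m majorana n \<mu>) * (w \<nu> \<cdot>\<^sub>m majorana n \<nu>)) $$ (i, j) =
        u \<mu> * w \<nu> * (majorana n \<mu> * majorana n \<nu>) $$ (i, j)"
      using i j dim_majorana [OF \<mu>] dim_majorana [OF \<nu>] by simp
  qed
  finally show ?thesis .
qed

text \<open>Bilinear extension of the Clifford relations: off-diagonal pairs cancel and each
  diagonal pair contributes twice the identity.\<close>

lemma maj_comb_anticommute:
  "maj_comb n u * maj_comb n w + maj_comb n w * maj_comb n u = (2 * dot n u w) \<cdot>\<^sub>m 1\<^sub>m (2 ^ n)"
proof (rule eq_matI)
  let ?I = "{1..2 * n}"
  fix i j assume "i < dim_row ((2 * dot n u w) \<cdot>\<^sub>m 1\<^sub>m (2 ^ n))" "j < dim_col ((2 * dot n u w) \<cdot>\<^sub>m 1\<^sub>m (2 ^ n))"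
  then have i: "i < 2 ^ n" and j: "j < 2 ^ n" by auto
  have rel: "(majorana n \<mu> * majorana n \<nu>) $$ (i, j) + (majorana n \<nu> * majorana n \<mu>) $$ (i, j) =
      (if \<nu> = \<mu> then 2 * 1\<^sub>m (2 ^ n) $$ (i, j) else 0)" if "\<mu> \<in> ?I" "\<nu> \<in> ?I" for \<mu> \<nu>
  proof (cases "\<mu> = \<nu>")
    case True
    then show ?thesis using majorana_square [OF that(1)] by simp
  next
    case False
    then show ?thesis
      using i j dim_majorana [OF that(1)] dim_majorana [OF that(2)]
      by (simp add: majorana_anticommute [OF that False] del: index_mult_mat(1))
  qed
  have "(maj_comb n u * maj_comb n w + maj_comb n w * maj_comb n u) $$ (i, j) =
      (\<Sum>\<mu>\<in>?I. \<Sum>\<nu>\<in>?I. u \<mu> * w \<nu> * (majorana n \<mu> * majorana n \<nu>) $$ (i, j)) +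
      (\<Sum>\<nu>\<in>?I. \<Sum>\<mu>\<in>?I. w \<nu> * u \<mu> * (majorana n \<nu> * majorana n \<mu>) $$ (i, j))"
    using i j by (simp add: index_maj_comb_mult del: index_mult_mat(1))
  \<comment> \<open>The second product is summed in swapped order so that its terms meet those of
    the first as anticommutators.\<close>
  also have "(\<Sum>\<nu>\<in>?I. \<Sum>\<mu>\<in>?I. w \<nu> * u \<mu> * (majorana n \<nu> * majorana n \<mu>) $$ (i, j)) =
      (\<Sum>\<mu>\<in>?I. \<Sum>\<nu>\<in>?I. w \<nu> * u \<mu> * (majorana n \<nu> * majorana n \<mu>) $$ (i, j))"
    by (rule sum.swap)
  also have "(\<Sum>\<mu>\<in>?I. \<Sum>\<nu>\<in>?I. u \<mu> * w \<nu> * (majorana n \<mu> * majorana n \<nu>) $$ (i, j)) + \<dots> =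
      (\<Sum>\<mu>\<in>?I. \<Sum>\<nu>\<in>?I. u \<mu> * w \<nu> *
        ((majorana n \<mu> * majorana n \<nu>) $$ (i, j) + (majorana n \<nu> * majorana n \<mu>) $$ (i, j)))"
    by (simp add: sum.distrib distrib_left mult.commute del: index_mult_mat(1))
  also have "\<dots> = (\<Sum>\<mu>\<in>?I. \<Sum>\<nu>\<in>?I. if \<nu> = \<mu> then u \<mu> * w \<nu> * (2 * 1\<^sub>m (2 ^ n) $$ (i, j)) else 0)"
    by (intro sum.cong refl) (simp add: rel del: index_mult_mat(1))
  also have "\<dots> = (\<Sum>\<mu>\<in>?I. u \<mu> * w \<mu> * (2 * 1\<^sub>m (2 ^ n) $$ (i, j)))"
    by (rule sum.cong) simp_all
  also have "\<dots> = ((2 * dot n u w) \<cdot>\<^sub>m 1\<^sub>m (2 ^ n)) $$ (i, j)"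
    using i j by (simp add: dot_def sum_distrib_left mult.commute mult.left_commute flip: sum_distrib_right)
  finally show "(maj_comb n u * maj_comb n w + maj_comb n w * maj_comb n u) $$ (i, j) =
      ((2 * dot n u w) \<cdot>\<^sub>m 1\<^sub>m (2 ^ n)) $$ (i, j)" .
qed auto

lemma maj_comb_square: "maj_comb n w * maj_comb n w = dot n w w \<cdot>\<^sub>m 1\<^sub>m (2 ^ n)"
proof (rule eq_matI)
  fix i j assume "i < dim_row (dot n w w \<cdot>\<^sub>m 1\<^sub>m (2 ^ n))" "j < dim_col (dot n w w \<cdot>\<^sub>m 1\<^sub>m (2 ^ n))"
  then have i: "i < 2 ^ n" and j: "j < 2 ^ n" by auto
  have "(maj_comb n w * maj_comb n w + maj_comb n w * maj_comb n w) $$ (i, j) =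
      ((2 * dot n w w) \<cdot>\<^sub>m 1\<^sub>m (2 ^ n)) $$ (i, j)"
    by (simp only: maj_comb_anticommute)
  then have "2 * (maj_comb n w * maj_comb n w) $$ (i, j) = 2 * (dot n w w \<cdot>\<^sub>m 1\<^sub>m (2 ^ n)) $$ (i, j)"
    using i j by (simp del: index_mult_mat(1))
  then show "(maj_comb n w * maj_comb n w) $$ (i, j) = (dot n w w \<cdot>\<^sub>m 1\<^sub>m (2 ^ n)) $$ (i, j)"
    by (simp only: mult_cancel_left) simp
qed auto

section \<open>Gaussian unitaries\<close>

lemma sum_lessThan_shift:
  fixes f :: "nat \<Rightarrow> 'a::comm_monoid_add"
  shows "(\<Sum>k<m. f k) = (\<Sum>\<rho>\<in>{1..m}. f (\<rho> - 1))"
  by (rule sum.reindex_bij_witness [of _ "\<lambda>\<rho>. \<rho> - 1" Suc]) auto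

lemma mat_sum_maj_comb:
  "mat_sum (2 ^ n) (\<lambda>\<mu>. w \<mu> \<cdot>\<^sub>m maj_comb n (q \<mu>)) I = maj_comb n (\<lambda>\<nu>. \<Sum>\<mu>\<in>I. w \<mu> * q \<mu> \<nu>)"
proof (rule eq_matI)
  fix i j assume "i < dim_row (maj_comb n (\<lambda>\<nu>. \<Sum>\<mu>\<in>I. w \<mu> * q \<mu> \<nu>))"
    "j < dim_col (maj_comb n (\<lambda>\<nu>. \<Sum>\<mu>\<in>I. w \<mu> * q \<mu> \<nu>))"
  then have i: "i < 2 ^ n" and j: "j < 2 ^ n" by auto
  have "mat_sum (2 ^ n) (\<lambda>\<mu>. w \<mu> \<cdot>\<^sub>m maj_comb n (q \<mu>)) I $$ (i, j) =
      (\<Sum>\<mu>\<in>I. \<Sum>\<nu>\<in>{1..2 * n}. w \<mu> * q \<mu> \<nu> * majorana n \<nu> $$ (i, j))"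
    using i j by (simp add: index_mat_sum index_maj_comb sum_distrib_left mult.assoc)
  also have "\<dots> = (\<Sum>\<nu>\<in>{1..2 * n}. \<Sum>\<mu>\<in>I. w \<mu> * q \<mu> \<nu> * majorana n \<nu> $$ (i, j))"
    by (rule sum.swap)
  also have "\<dots> = maj_comb n (\<lambda>\<nu>. \<Sum>\<mu>\<in>I. w \<mu> * q \<mu> \<nu>) $$ (i, j)"
    using i j by (simp add: index_maj_comb sum_distrib_right)
  finally show "mat_sum (2 ^ n) (\<lambda>\<mu>. w \<mu> \<cdot>\<^sub>m maj_comb n (q \<mu>)) I $$ (i, j) =
      maj_comb n (\<lambda>\<nu>. \<Sum>\<mu>\<in>I. w \<mu> * q \<mu> \<nu>) $$ (i, j)" .
qed (auto simp: mat_sum_def)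

text \<open>Linearity extends a conjugation rule from single Majorana operators to all complex
  combinations; the coefficient vector is multiplied by q from the right.\<close>

lemma conj_maj_comb:
  assumes A: "A \<in> carrier_mat (2 ^ n) (2 ^ n)" and B: "B \<in> carrier_mat (2 ^ n) (2 ^ n)"
    and AB: "\<And>\<mu>. \<mu> \<in> {1..2 * n} \<Longrightarrow> A * majorana n \<mu> * B = maj_comb n (q \<mu>)"
  shows "A * maj_comb n w * B = maj_comb n (\<lambda>\<nu>. \<Sum>\<mu>\<in>{1..2 * n}. w \<mu> * q \<mu> \<nu>)"
proof -
  have "A * maj_comb n w = mat_sum (2 ^ n) (\<lambda>\<mu>. A * (w \<mu> \<cdot>\<^sub>m majorana n \<mu>)) {1..2 * n}"
    unfolding maj_comb_def using A by (intro mult_mat_sum) auto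
  then have "A * maj_comb n w * B = mat_sum (2 ^ n) (\<lambda>\<mu>. A * (w \<mu> \<cdot>\<^sub>m majorana n \<mu>)) {1..2 * n} * B"
    by simp
  also have "\<dots> = mat_sum (2 ^ n) (\<lambda>\<mu>. A * (w \<mu> \<cdot>\<^sub>m majorana n \<mu>) * B) {1..2 * n}"
    using A B by (intro mat_sum_mult) (auto intro!: mult_carrier_mat [where n = "2 ^ n"])
  also have "\<dots> = mat_sum (2 ^ n) (\<lambda>\<mu>. w \<mu> \<cdot>\<^sub>m maj_comb n (q \<mu>)) {1..2 * n}"
  proof (rule mat_sum_cong)
    fix \<mu> assume \<mu>: "\<mu> \<in> {1..2 * n}"
    have "A * (w \<mu> \<cdot>\<^sub>m majorana n \<mu>) * B = w \<mu> \<cdot>\<^sub>m (A * majorana n \<mu>) * B"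
      using mult_smult_distrib [OF A majorana_carrier [OF \<mu>]] by simp
    also have "\<dots> = w \<mu> \<cdot>\<^sub>m (A * majorana n \<mu> * B)"
      by (rule mult_smult_assoc_mat [OF mult_carrier_mat [OF A majorana_carrier [OF \<mu>]] B])
    finally show "A * (w \<mu> \<cdot>\<^sub>m majorana n \<mu>) * B = w \<mu> \<cdot>\<^sub>m maj_comb n (q \<mu>)"
      using AB [OF \<mu>] by simp
  qed
  also have "\<dots> = maj_comb n (\<lambda>\<nu>. \<Sum>\<mu>\<in>{1..2 * n}. w \<mu> * q \<mu> \<nu>)" by (rule mat_sum_maj_comb)
  finally show ?thesis .
qed

lemma unitary_matD:
  assumes "unitary_mat d G"
  shows "G \<in> carrier_mat d d" "mat_adjoint G \<in> carrier_mat d d"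
    "mat_adjoint G * G = 1\<^sub>m d" "G * mat_adjoint G = 1\<^sub>m d"
  using assms by (auto simp: unitary_mat_def)

lemma unitary_mat_mult:
  assumes G: "unitary_mat d G" and H: "unitary_mat d H"
  shows "unitary_mat d (G * H)"
proof -
  note G = unitary_matD [OF G] and H = unitary_matD [OF H]
  have adj: "mat_adjoint (G * H) = mat_adjoint H * mat_adjoint G"
    by (rule mat_adjoint_mult [OF G(1) H(1)])
  have "mat_adjoint H * mat_adjoint G * (G * H) = mat_adjoint H * (mat_adjoint G * G * H)"
    using assoc_mult_mat [OF H(2) G(2) mult_carrier_mat [OF G(1) H(1)]] assoc_mult_mat [OF G(2) G(1) H(1)]
    by simp
  also have "\<dots> = 1\<^sub>m d" using G H by simp
  finally have 1: "mat_adjoint (G * H) * (G * H) = 1\<^sub>m d" using adj by simp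
  have "G * H * (mat_adjoint H * mat_adjoint G) = G * (H * mat_adjoint H * mat_adjoint G)"
    using assoc_mult_mat [OF G(1) H(1) mult_carrier_mat [OF H(2) G(2)]] assoc_mult_mat [OF H(1) H(2) G(2)]
    by simp
  also have "\<dots> = 1\<^sub>m d" using G H by simp
  finally have 2: "G * H * mat_adjoint (G * H) = 1\<^sub>m d" using adj by simp
  show ?thesis
    unfolding unitary_mat_def using 1 2 mult_carrier_mat [OF G(1) H(1)] by simp
qed

lemma gaussian_unitaryI:
  assumes "unitary_mat (2 ^ n) G" "Q \<in> orthogonal_group (2 * n)"
    "\<And>\<mu>. \<mu> \<in> {1..2 * n} \<Longrightarrow> mat_adjoint G * majorana n \<mu> * G =
      maj_comb n (\<lambda>\<nu>. complex_of_real (Q $$ (\<mu> - 1, \<nu> - 1)))"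
  shows "gaussian_unitary n G"
  using assms unfolding gaussian_unitary_def maj_comb_def by blast

lemma gaussian_unitaryE:
  assumes "gaussian_unitary n G"
  obtains Q where "unitary_mat (2 ^ n) G" "Q \<in> orthogonal_group (2 * n)"
    "\<And>\<mu>. \<mu> \<in> {1..2 * n} \<Longrightarrow> mat_adjoint G * majorana n \<mu> * G =
      maj_comb n (\<lambda>\<nu>. complex_of_real (Q $$ (\<mu> - 1, \<nu> - 1)))"
proof -
  obtain Q where "Q \<in> orthogonal_group (2 * n)"
    "\<forall>\<mu>\<in>{1..2 * n}. mat_adjoint G * majorana n \<mu> * G =
      maj_comb n (\<lambda>\<nu>. complex_of_real (Q $$ (\<mu> - 1, \<nu> - 1)))"
    using assms unfolding gaussian_unitary_def maj_comb_def by (elim conjE bexE)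
  moreover have "unitary_mat (2 ^ n) G" using assms by (simp add: gaussian_unitary_def)
  ultimately show thesis using that by blast
qed

lemma orthogonal_group_mult:
  assumes Q: "Q \<in> orthogonal_group m" and R: "R \<in> orthogonal_group m"
  shows "Q * R \<in> orthogonal_group m"
proof -
  have Q': "Q \<in> carrier_mat m m" "transpose_mat Q \<in> carrier_mat m m"
    "transpose_mat Q * Q = 1\<^sub>m m" "Q * transpose_mat Q = 1\<^sub>m m"
    and R': "R \<in> carrier_mat m m" "transpose_mat R \<in> carrier_mat m m"
    "transpose_mat R * R = 1\<^sub>m m" "R * transpose_mat R = 1\<^sub>m m"
    using Q R by (auto simp: orthogonal_group_def)
  have t: "transpose_mat (Q * R) = transpose_mat R * transpose_mat Q"
    by (rule transpose_mult [OF Q'(1) R'(1)])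
  have "transpose_mat R * transpose_mat Q * (Q * R) = transpose_mat R * (transpose_mat Q * Q * R)"
    using assoc_mult_mat [OF R'(2) Q'(2) mult_carrier_mat [OF Q'(1) R'(1)]]
      assoc_mult_mat [OF Q'(2) Q'(1) R'(1)] by simp
  then have 1: "transpose_mat (Q * R) * (Q * R) = 1\<^sub>m m" using Q' R' t by simp
  have "Q * R * (transpose_mat R * transpose_mat Q) = Q * (R * transpose_mat R * transpose_mat Q)"
    using assoc_mult_mat [OF Q'(1) R'(1) mult_carrier_mat [OF R'(2) Q'(2)]]
      assoc_mult_mat [OF R'(1) R'(2) Q'(2)] by simp
  then have 2: "Q * R * transpose_mat (Q * R) = 1\<^sub>m m" using Q' R' t by simp
  show ?thesis
    unfolding orthogonal_group_def using 1 2 mult_carrier_mat [OF Q'(1) R'(1)] by simp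
qed

lemma gaussian_unitary_mult:
  assumes "gaussian_unitary n G" "gaussian_unitary n H"
  shows "gaussian_unitary n (G * H)"
proof -
  obtain Q where G: "unitary_mat (2 ^ n) G" and Q: "Q \<in> orthogonal_group (2 * n)"
    and GQ: "\<And>\<mu>. \<mu> \<in> {1..2 * n} \<Longrightarrow> mat_adjoint G * majorana n \<mu> * G =
      maj_comb n (\<lambda>\<nu>. complex_of_real (Q $$ (\<mu> - 1, \<nu> - 1)))"
    using assms(1) by (rule gaussian_unitaryE) blast
  obtain R where H: "unitary_mat (2 ^ n) H" and R: "R \<in> orthogonal_group (2 * n)"
    and HR: "\<And>\<mu>. \<mu> \<in> {1..2 * n} \<Longrightarrow> mat_adjoint H * majorana n \<mu> * H =
      maj_comb n (\<lambda>\<nu>. complex_of_real (R $$ (\<mu> - 1, \<nu> - 1)))"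
    using assms(2) by (rule gaussian_unitaryE) blast
  note G' = unitary_matD [OF G] and H' = unitary_matD [OF H]
  have QR: "Q \<in> carrier_mat (2 * n) (2 * n)" "R \<in> carrier_mat (2 * n) (2 * n)"
    using Q R by (auto simp: orthogonal_group_def)
  show ?thesis
  proof (rule gaussian_unitaryI)
    fix \<mu> assume \<mu>: "\<mu> \<in> {1..2 * n}"
    note M = majorana_carrier [OF \<mu>]
    have "mat_adjoint (G * H) * majorana n \<mu> * (G * H) =
        mat_adjoint H * (mat_adjoint G * majorana n \<mu> * G) * H"
      using mat_adjoint_mult [OF G'(1) H'(1)]
        assoc_mult_mat [OF H'(2) G'(2) M]
        assoc_mult_mat [OF H'(2) mult_carrier_mat [OF G'(2) M] mult_carrier_mat [OF G'(1) H'(1)]]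
        assoc_mult_mat [OF mult_carrier_mat [OF G'(2) M] G'(1) H'(1)]
        assoc_mult_mat [OF H'(2) mult_carrier_mat [OF mult_carrier_mat [OF G'(2) M] G'(1)] H'(1)]
      by simp
    also have "\<dots> = maj_comb n (\<lambda>\<nu>. \<Sum>\<rho>\<in>{1..2 * n}.
        complex_of_real (Q $$ (\<mu> - 1, \<rho> - 1)) * complex_of_real (R $$ (\<rho> - 1, \<nu> - 1)))"
      by (simp only: GQ [OF \<mu>]) (rule conj_maj_comb [OF H'(2,1) HR])
    also have "\<dots> = maj_comb n (\<lambda>\<nu>. complex_of_real ((Q * R) $$ (\<mu> - 1, \<nu> - 1)))"
    proof (rule maj_comb_cong)
      fix \<nu> assume \<nu>: "\<nu> \<in> {1..2 * n}"
      have lt: "\<mu> - 1 < 2 * n" "\<nu> - 1 < 2 * n" using \<mu> \<nu> by auto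
      show "(\<Sum>\<rho>\<in>{1..2 * n}. complex_of_real (Q $$ (\<mu> - 1, \<rho> - 1)) * complex_of_real (R $$ (\<rho> - 1, \<nu> - 1)))
          = complex_of_real ((Q * R) $$ (\<mu> - 1, \<nu> - 1))"
        unfolding index_mult_mat_sum [OF QR lt] by (simp add: sum_lessThan_shift)
    qed
    finally show "mat_adjoint (G * H) * majorana n \<mu> * (G * H) =
        maj_comb n (\<lambda>\<nu>. complex_of_real ((Q * R) $$ (\<mu> - 1, \<nu> - 1)))" .
  qed (use G H Q R in \<open>auto intro: unitary_mat_mult orthogonal_group_mult\<close>)
qed

lemma gaussian_unitary_one: "gaussian_unitary n (1\<^sub>m (2 ^ n))"
proof (rule gaussian_unitaryI)
  fix \<mu> assume \<mu>: "\<mu> \<in> {1..2 * n}"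
  have "mat_adjoint (1\<^sub>m (2 ^ n)) * majorana n \<mu> * 1\<^sub>m (2 ^ n) = majorana n \<mu>"
    using majorana_carrier [OF \<mu>] by simp
  also have "\<dots> = maj_comb n (\<lambda>\<nu>. if \<nu> = \<mu> then 1 else 0)"
    by (rule maj_comb_single [OF \<mu>, symmetric])
  also have "\<dots> = maj_comb n (\<lambda>\<nu>. complex_of_real (1\<^sub>m (2 * n) $$ (\<mu> - 1, \<nu> - 1)))"
    using \<mu> by (intro maj_comb_cong) auto
  finally show "mat_adjoint (1\<^sub>m (2 ^ n)) * majorana n \<mu> * 1\<^sub>m (2 ^ n) =
      maj_comb n (\<lambda>\<nu>. complex_of_real (1\<^sub>m (2 * n) $$ (\<mu> - 1, \<nu> - 1)))" .
qed (auto simp: unitary_mat_def orthogonal_group_def)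

lemma add_smult_mat_eq:
  fixes A B C :: "complex mat"
  assumes "A + B = C" "A \<in> carrier_mat d d" "B \<in> carrier_mat d d"
  shows "A = C + (- 1) \<cdot>\<^sub>m B"
proof (rule eq_matI)
  fix i j assume ij: "i < dim_row (C + (- 1) \<cdot>\<^sub>m B)" "j < dim_col (C + (- 1) \<cdot>\<^sub>m B)"
  then show "A $$ (i, j) = (C + (- 1) \<cdot>\<^sub>m B) $$ (i, j)"
    using assms(2,3) unfolding assms(1) [symmetric] by auto
qed (use assms in auto)

text \<open>Moving v past w by the Clifford relation leaves v squared, which is the identity. The
  result is minus the Householder reflection of w; since the form is bilinear, w may be
  complex.\<close>

lemma maj_comb_conj:
  assumes v: "dot n v v = 1"
  shows "maj_comb n v * maj_comb n w * maj_comb n v = maj_comb n (\<lambda>\<nu>. 2 * dot n v w * v \<nu> - w \<nu>)"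
proof -
  let ?V = "maj_comb n v" and ?W = "maj_comb n w" and ?d = "(2 :: nat) ^ n"
  have "?V * ?W = (2 * dot n v w) \<cdot>\<^sub>m 1\<^sub>m ?d + (- 1) \<cdot>\<^sub>m (?W * ?V)"
    by (rule add_smult_mat_eq [OF maj_comb_anticommute]) auto
  then have "?V * ?W * ?V = ((2 * dot n v w) \<cdot>\<^sub>m 1\<^sub>m ?d) * ?V + ((- 1) \<cdot>\<^sub>m (?W * ?V)) * ?V"
    using add_mult_distrib_mat [of "(2 * dot n v w) \<cdot>\<^sub>m 1\<^sub>m ?d" ?d ?d "(- 1) \<cdot>\<^sub>m (?W * ?V)" ?V ?d]
      mult_carrier_mat [OF maj_comb_carrier maj_comb_carrier, of n w v]
    by simp
  also have "((2 * dot n v w) \<cdot>\<^sub>m 1\<^sub>m ?d) * ?V = (2 * dot n v w) \<cdot>\<^sub>m ?V"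
    using mult_smult_assoc_mat [OF one_carrier_mat maj_comb_carrier, of "2 * dot n v w" n v]
    by (simp add: left_mult_one_mat [OF maj_comb_carrier])
  also have "((- 1) \<cdot>\<^sub>m (?W * ?V)) * ?V = (- 1) \<cdot>\<^sub>m (?W * (?V * ?V))"
    using mult_smult_assoc_mat [OF mult_carrier_mat [OF maj_comb_carrier maj_comb_carrier] maj_comb_carrier]
      assoc_mult_mat [OF maj_comb_carrier maj_comb_carrier maj_comb_carrier] by metis
  also have "?V * ?V = 1\<^sub>m ?d"
    using v by (simp add: maj_comb_square) (rule eq_matI; simp)
  also have "?W * 1\<^sub>m ?d = ?W" by (rule right_mult_one_mat [OF maj_comb_carrier])
  also have "(2 * dot n v w) \<cdot>\<^sub>m ?V + (- 1) \<cdot>\<^sub>m ?W = maj_comb n (\<lambda>\<nu>. 2 * dot n v w * v \<nu> + (- 1) * w \<nu>)"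
    by (simp only: maj_comb_add maj_comb_smult)
  finally show ?thesis by simp
qed

text \<open>Real coefficients make the operator self-adjoint and unit length makes it an involution,
  hence it is unitary. Its orthogonal matrix is read off from \<open>maj_comb_conj\<close>.\<close>

lemma gaussian_unitary_maj_comb:
  fixes v :: "nat \<Rightarrow> real"
  assumes v: "(\<Sum>\<nu>\<in>{1..2 * n}. v \<nu> * v \<nu>) = 1"
  shows "gaussian_unitary n (maj_comb n (\<lambda>\<nu>. complex_of_real (v \<nu>)))"
proof (rule gaussian_unitaryI)
  let ?v = "\<lambda>\<nu>. complex_of_real (v \<nu>)"
  \<comment> \<open>Twice the projection onto v minus the identity; \<open>Suc\<close> translates
    matrix indices from 0 into Majorana labels from 1.\<close>
  define Q where "Q = mat (2 * n) (2 * n) (\<lambda>(i, j). 2 * v (Suc i) * v (Suc j) - (if i = j then 1 else 0))"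
  have vv: "dot n ?v ?v = 1"
    using arg_cong [OF v, of complex_of_real] by (simp add: dot_def)
  have adj: "mat_adjoint (maj_comb n ?v) = maj_comb n ?v" by (simp add: maj_comb_adjoint)
  have sq: "maj_comb n ?v * maj_comb n ?v = 1\<^sub>m (2 ^ n)"
    using vv by (simp add: maj_comb_square) (rule eq_matI; simp)
  show "unitary_mat (2 ^ n) (maj_comb n ?v)"
    by (simp add: unitary_mat_def adj sq)
  have QC: "Q \<in> carrier_mat (2 * n) (2 * n)" by (simp add: Q_def)
  have QT: "transpose_mat Q = Q" by (rule eq_matI) (auto simp: Q_def)
  have v': "(\<Sum>k<2 * n. v (Suc k) * v (Suc k)) = 1"
    unfolding sum_lessThan_shift v [symmetric] by (rule sum.cong) auto
  have "Q * Q = 1\<^sub>m (2 * n)"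
  proof (rule eq_matI)
    fix i j assume "i < dim_row (1\<^sub>m (2 * n) :: real mat)" "j < dim_col (1\<^sub>m (2 * n) :: real mat)"
    then have i: "i < 2 * n" and j: "j < 2 * n" by auto
    have "(Q * Q) $$ (i, j) = (\<Sum>k<2 * n. (2 * v (Suc i) * v (Suc k) - (if i = k then 1 else 0)) *
        (2 * v (Suc k) * v (Suc j) - (if k = j then 1 else 0)))"
      unfolding index_mult_mat_sum [OF QC QC i j] by (rule sum.cong) (use i j in \<open>auto simp: Q_def\<close>)
    \<comment> \<open>Each Kronecker delta is brought into the form of a test on k, so that its sum
      collapses to one term.\<close>
    also have "\<dots> = (\<Sum>k<2 * n. 4 * v (Suc i) * v (Suc j) * (v (Suc k) * v (Suc k))
        - (if k = j then 2 * v (Suc i) * v (Suc k) else 0)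
        - (if k = i then 2 * v (Suc k) * v (Suc j) else 0)
        + (if k = i then if i = j then 1 else 0 else 0))"
      by (rule sum.cong) (auto simp: algebra_simps)
    also have "\<dots> = 4 * v (Suc i) * v (Suc j) * (\<Sum>k<2 * n. v (Suc k) * v (Suc k))
        - 2 * v (Suc i) * v (Suc j) - 2 * v (Suc i) * v (Suc j) + (if i = j then 1 else 0)"
      using i j by (simp add: sum.distrib sum_subtractf sum_distrib_left)
    also have "\<dots> = 1\<^sub>m (2 * n) $$ (i, j)" using i j by (simp add: v')
    finally show "(Q * Q) $$ (i, j) = 1\<^sub>m (2 * n) $$ (i, j)" .
  qed (use QC in auto)
  then show "Q \<in> orthogonal_group (2 * n)" by (simp add: orthogonal_group_def QC QT)
  fix \<mu> assume \<mu>: "\<mu> \<in> {1..2 * n}"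
  let ?e = "\<lambda>\<nu>. if \<nu> = \<mu> then 1 else 0"
  have dot: "dot n ?v ?e = ?v \<mu>"
  proof -
    have "dot n ?v ?e = (\<Sum>\<nu>\<in>{1..2 * n}. if \<nu> = \<mu> then ?v \<nu> else 0)"
      unfolding dot_def by (rule sum.cong) simp_all
    also have "\<dots> = ?v \<mu>" using \<mu> by simp
    finally show ?thesis .
  qed
  have "mat_adjoint (maj_comb n ?v) * majorana n \<mu> * maj_comb n ?v =
      maj_comb n ?v * maj_comb n ?e * maj_comb n ?v"
    by (simp only: adj maj_comb_single [OF \<mu>])
  also have "\<dots> = maj_comb n (\<lambda>\<nu>. 2 * ?v \<mu> * ?v \<nu> - ?e \<nu>)"
    by (simp only: maj_comb_conj [OF vv] dot)
  also have "\<dots> = maj_comb n (\<lambda>\<nu>. complex_of_real (Q $$ (\<mu> - 1, \<nu> - 1)))"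
    by (rule maj_comb_cong) (use \<mu> in \<open>auto simp: Q_def\<close>)
  finally show "mat_adjoint (maj_comb n ?v) * majorana n \<mu> * maj_comb n ?v =
      maj_comb n (\<lambda>\<nu>. complex_of_real (Q $$ (\<mu> - 1, \<nu> - 1)))" .
qed

section \<open>Annihilators of a state\<close>

text \<open>Gaussian elimination: one equation removes one unknown. The induction runs on an upper
  bound m for the number of equations because the reduced equations form an image set, whose
  cardinality may drop further.\<close>

lemma underdetermined_system:
  fixes F :: "('i \<Rightarrow> 'a::field) set"
  assumes "finite F" "finite K" "card F < card K"
  shows "\<exists>c. (\<exists>k\<in>K. c k \<noteq> 0) \<and> (\<forall>g\<in>F. (\<Sum>k\<in>K. g k * c k) = 0)"
proof -
  have "\<exists>c. (\<exists>k\<in>K. c k \<noteq> 0) \<and> (\<forall>g\<in>F. (\<Sum>k\<in>K. g k * c k) = 0)"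
    if "finite F" "finite K" "card F \<le> m" "m < card K" for m and F :: "('i \<Rightarrow> 'a) set" and K
    using that
  proof (induction m arbitrary: F K)
    case 0
    then have "F = {}" "K \<noteq> {}" by auto
    then show ?case by (intro exI [of _ "\<lambda>_. 1"]) auto
  next
    case (Suc m)
    show ?case
    proof (cases "F = {}")
      case True
      then show ?thesis using Suc.IH [of F K] Suc.prems by auto
    next
      case False
      then obtain g where g: "g \<in> F" by blast
      define F0 where "F0 = F - {g}"
      have F0: "finite F0" "card F0 \<le> m" using Suc.prems g by (auto simp: F0_def)
      have F: "F = insert g F0" using g by (auto simp: F0_def)
      show ?thesis
      proof (cases "\<forall>k\<in>K. g k = 0")
        case True
        obtain c where "\<exists>k\<in>K. c k \<noteq> 0" "\<forall>h\<in>F0. (\<Sum>k\<in>K. h k * c k) = 0"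
          using Suc.IH [OF F0(1) Suc.prems(2) F0(2)] Suc.prems(4) by auto
        then show ?thesis using True by (intro exI [of _ c]) (simp add: F)
      next
        case False
        then obtain k0 where k0: "k0 \<in> K" "g k0 \<noteq> 0" by blast
        define K0 where "K0 = K - {k0}"
        \<comment> \<open>Subtracting a multiple of \<open>g\<close> clears the coefficient of the
          pivot unknown \<open>k0\<close> in every other equation.\<close>
        define F1 where "F1 = (\<lambda>h k. h k - h k0 * g k / g k0) ` F0"
        have "finite F1" "finite K0" using F0(1) Suc.prems(2) by (auto simp: F1_def K0_def)
        moreover have "card F1 \<le> m"
          using card_image_le [OF F0(1)] F0(2) unfolding F1_def by (rule order_trans)
        moreover have "m < card K0" using Suc.prems k0 by (simp add: K0_def)
        ultimately obtain c where c: "\<exists>k\<in>K0. c k \<noteq> 0" "\<forall>h\<in>F1. (\<Sum>k\<in>K0. h k * c k) = 0"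
          using Suc.IH by blast
        \<comment> \<open>Back substitution: the value at \<open>k0\<close> is the one that solves
          equation \<open>g\<close>.\<close>
        define c' where "c' = c(k0 := - (\<Sum>k\<in>K0. g k * c k) / g k0)"
        have sum: "(\<Sum>k\<in>K. h k * c' k) = h k0 * c' k0 + (\<Sum>k\<in>K0. h k * c k)" for h
        proof -
          have "(\<Sum>k\<in>K0. h k * c' k) = (\<Sum>k\<in>K0. h k * c k)"
            by (rule sum.cong) (auto simp: c'_def K0_def)
          then show ?thesis
            using sum.remove [OF Suc.prems(2) k0(1), of "\<lambda>k. h k * c' k"] by (simp add: K0_def)
        qed
        have "(\<Sum>k\<in>K. g k * c' k) = 0" unfolding sum using k0(2) by (simp add: c'_def)
        moreover have "(\<Sum>k\<in>K. h k * c' k) = 0" if "h \<in> F0" for h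
        proof -
          have "(\<Sum>k\<in>K0. (h k - h k0 * g k / g k0) * c k) = 0" using c(2) that by (auto simp: F1_def)
          then have "(\<Sum>k\<in>K0. h k * c k) = h k0 / g k0 * (\<Sum>k\<in>K0. g k * c k)"
            by (simp add: left_diff_distrib sum_subtractf sum_distrib_left mult.assoc)
          then show ?thesis unfolding sum by (simp add: c'_def)
        qed
        moreover have "\<exists>k\<in>K. c' k \<noteq> 0" using c(1) by (auto simp: c'_def K0_def)
        ultimately show ?thesis by (auto simp: F)
      qed
    qed
  qed
  then show ?thesis using assms by blast
qed

definition annihilates :: "nat \<Rightarrow> (nat \<Rightarrow> complex) \<Rightarrow> complex vec \<Rightarrow> bool" where
  "annihilates n w \<psi> \<longleftrightarrow> maj_comb n w *\<^sub>v \<psi> = 0\<^sub>v (2 ^ n)"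

text \<open>The space of \<open>w \<in> \<complex>\<^bsup>2n\<^esup>\<close> annihilating \<open>\<psi>\<close> has dimension at least \<open>m\<close>, expressed by the fact
  that it meets the kernel of any fewer than \<open>m\<close> linear functionals nontrivially.\<close>

definition annihilator_dim_ge :: "nat \<Rightarrow> nat \<Rightarrow> complex vec \<Rightarrow> bool" where
  "annihilator_dim_ge n m \<psi> \<longleftrightarrow> (\<forall>F. finite F \<and> card F < m \<longrightarrow>
     (\<exists>w. annihilates n w \<psi> \<and> (\<exists>\<mu>\<in>{1..2 * n}. w \<mu> \<noteq> 0) \<and> (\<forall>g\<in>F. dot n g w = 0)))"

lemma dot_single:
  assumes "\<mu> \<in> {1..2 * n}"
  shows "dot n w (\<lambda>\<nu>. if \<nu> = \<mu> then 1 else 0) = w \<mu>" "dot n (\<lambda>\<nu>. if \<nu> = \<mu> then 1 else 0) w = w \<mu>"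
proof -
  have "dot n w (\<lambda>\<nu>. if \<nu> = \<mu> then 1 else 0) = (\<Sum>\<nu>\<in>{1..2 * n}. if \<nu> = \<mu> then w \<nu> else 0)"
    unfolding dot_def by (rule sum.cong) simp_all
  also have "\<dots> = w \<mu>" using assms by simp
  finally show "dot n w (\<lambda>\<nu>. if \<nu> = \<mu> then 1 else 0) = w \<mu>" .
  then show "dot n (\<lambda>\<nu>. if \<nu> = \<mu> then 1 else 0) w = w \<mu>"
    by (simp add: dot_def mult.commute)
qed

lemma mult_zero_vec: "A \<in> carrier_mat d d \<Longrightarrow> (A :: complex mat) *\<^sub>v 0\<^sub>v d = 0\<^sub>v d"
  by (intro eq_vecI) auto

section \<open>Effect of the gates on the annihilator\<close>

text \<open>If w annihilates the old state, then Q w annihilates the new one. The functionals are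
  pulled back along Q, which does not increase their number.\<close>

lemma annihilator_dim_ge_gaussian:
  assumes G: "gaussian_unitary n G" and \<psi>: "\<psi> \<in> carrier_vec (2 ^ n)" and m: "annihilator_dim_ge n m \<psi>"
  shows "annihilator_dim_ge n m (G *\<^sub>v \<psi>)"
  unfolding annihilator_dim_ge_def
proof (intro allI impI)
  let ?I = "{1..2 * n}"
  fix F :: "(nat \<Rightarrow> complex) set" assume F: "finite F \<and> card F < m"
  obtain Q where U: "unitary_mat (2 ^ n) G" and Q: "Q \<in> orthogonal_group (2 * n)"
    and GQ: "\<And>\<mu>. \<mu> \<in> {1..2 * n} \<Longrightarrow> mat_adjoint G * majorana n \<mu> * G =
      maj_comb n (\<lambda>\<nu>. complex_of_real (Q $$ (\<mu> - 1, \<nu> - 1)))"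
    using G by (rule gaussian_unitaryE) blast
  note U' = unitary_matD [OF U]
  define q where "q \<mu> \<nu> = complex_of_real (Q $$ (\<mu> - 1, \<nu> - 1))" for \<mu> \<nu>
  have ortho: "(\<Sum>\<mu>\<in>?I. q \<mu> \<nu> * q \<mu> \<rho>) = (if \<rho> = \<nu> then 1 else 0)" if "\<nu> \<in> ?I" "\<rho> \<in> ?I" for \<nu> \<rho>
  proof -
    have QC: "Q \<in> carrier_mat (2 * n) (2 * n)" "transpose_mat Q \<in> carrier_mat (2 * n) (2 * n)"
      "transpose_mat Q * Q = 1\<^sub>m (2 * n)"
      using Q by (auto simp: orthogonal_group_def)
    have lt: "\<nu> - 1 < 2 * n" "\<rho> - 1 < 2 * n" using that by auto
    have "(if \<rho> = \<nu> then 1 else 0) = (transpose_mat Q * Q) $$ (\<nu> - 1, \<rho> - 1)"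
      using QC(3) lt that by auto
    also have "\<dots> = (\<Sum>k<2 * n. Q $$ (k, \<nu> - 1) * Q $$ (k, \<rho> - 1))"
      unfolding index_mult_mat_sum [OF QC(2,1) lt] by (rule sum.cong) (use QC(1) lt in auto)
    also have "\<dots> = (\<Sum>\<mu>\<in>?I. Q $$ (\<mu> - 1, \<nu> - 1) * Q $$ (\<mu> - 1, \<rho> - 1))" by (rule sum_lessThan_shift)
    finally have "complex_of_real (if \<rho> = \<nu> then 1 else 0) = (\<Sum>\<mu>\<in>?I. q \<mu> \<nu> * q \<mu> \<rho>)"
      by (simp add: q_def)
    then show ?thesis by (simp split: if_splits)
  qed
  \<comment> \<open>The pullback of g is g times Q, so that its value on w equals the value of g on
    u = Q w.\<close>
  define F' where "F' = (\<lambda>g \<nu>. \<Sum>\<mu>\<in>?I. g \<mu> * q \<mu> \<nu>) ` F"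
  have "finite F'" "card F' < m"
    using F card_image_le [of F] by (auto simp: F'_def intro: le_less_trans)
  then obtain w where w: "annihilates n w \<psi>" "\<exists>\<mu>\<in>?I. w \<mu> \<noteq> 0" "\<forall>g\<in>F'. dot n g w = 0"
    using m unfolding annihilator_dim_ge_def by blast
  define u where "u \<mu> = (\<Sum>\<nu>\<in>?I. q \<mu> \<nu> * w \<nu>)" for \<mu>
  have w_eq: "(\<Sum>\<mu>\<in>?I. u \<mu> * q \<mu> \<nu>) = w \<nu>" if \<nu>: "\<nu> \<in> ?I" for \<nu>
  proof -
    have "(\<Sum>\<mu>\<in>?I. u \<mu> * q \<mu> \<nu>) = (\<Sum>\<mu>\<in>?I. \<Sum>\<rho>\<in>?I. q \<mu> \<nu> * q \<mu> \<rho> * w \<rho>)"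
      unfolding u_def sum_distrib_right by (intro sum.cong refl) (simp add: mult_ac)
    also have "\<dots> = (\<Sum>\<rho>\<in>?I. \<Sum>\<mu>\<in>?I. q \<mu> \<nu> * q \<mu> \<rho> * w \<rho>)" by (rule sum.swap)
    also have "\<dots> = (\<Sum>\<rho>\<in>?I. (\<Sum>\<mu>\<in>?I. q \<mu> \<nu> * q \<mu> \<rho>) * w \<rho>)"
      by (simp only: sum_distrib_right)
    also have "\<dots> = (\<Sum>\<rho>\<in>?I. if \<rho> = \<nu> then w \<rho> else 0)"
      by (rule sum.cong) (use ortho [OF \<nu>] in simp_all)
    also have "\<dots> = w \<nu>" using \<nu> by simp
    finally show ?thesis .
  qed
  have "maj_comb n u * G = G * (mat_adjoint G * maj_comb n u * G)"
  proof -
    have "G * (mat_adjoint G * (maj_comb n u * G)) = G * mat_adjoint G * (maj_comb n u * G)"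
      using assoc_mult_mat [OF U'(1,2) mult_carrier_mat [OF maj_comb_carrier U'(1)]] by simp
    then show ?thesis
      using U'(4) assoc_mult_mat [OF U'(2) maj_comb_carrier U'(1)]
        left_mult_one_mat [OF mult_carrier_mat [OF maj_comb_carrier U'(1)]] by simp
  qed
  also have "mat_adjoint G * maj_comb n u * G = maj_comb n (\<lambda>\<nu>. \<Sum>\<mu>\<in>?I. u \<mu> * q \<mu> \<nu>)"
    unfolding q_def by (rule conj_maj_comb [OF U'(2,1) GQ])
  also have "\<dots> = maj_comb n w" by (rule maj_comb_cong) (rule w_eq)
  finally have uG: "maj_comb n u * G = G * maj_comb n w" .
  have "maj_comb n u *\<^sub>v (G *\<^sub>v \<psi>) = G *\<^sub>v (maj_comb n w *\<^sub>v \<psi>)"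
    using assoc_mult_mat_vec [OF maj_comb_carrier U'(1) \<psi>, of u]
      assoc_mult_mat_vec [OF U'(1) maj_comb_carrier \<psi>, of w] uG by simp
  then have "annihilates n u (G *\<^sub>v \<psi>)"
    using w(1) mult_zero_vec [OF U'(1)] by (simp add: annihilates_def)
  moreover have "\<exists>\<mu>\<in>?I. u \<mu> \<noteq> 0"
  proof (rule ccontr)
    assume "\<not> (\<exists>\<mu>\<in>?I. u \<mu> \<noteq> 0)"
    then have "w \<nu> = 0" if "\<nu> \<in> ?I" for \<nu> using w_eq [OF that] by simp
    then show False using w(2) by blast
  qed
  moreover have "dot n g u = 0" if g: "g \<in> F" for g
  proof -
    have "dot n g u = (\<Sum>\<mu>\<in>?I. \<Sum>\<nu>\<in>?I. g \<mu> * q \<mu> \<nu> * w \<nu>)"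
      by (simp add: dot_def u_def sum_distrib_left mult.assoc)
    also have "\<dots> = (\<Sum>\<nu>\<in>?I. \<Sum>\<mu>\<in>?I. g \<mu> * q \<mu> \<nu> * w \<nu>)" by (rule sum.swap)
    also have "\<dots> = dot n (\<lambda>\<nu>. \<Sum>\<mu>\<in>?I. g \<mu> * q \<mu> \<nu>) w" by (simp add: dot_def sum_distrib_right)
    also have "\<dots> = 0" using w(3) g by (auto simp: F'_def)
    finally show ?thesis .
  qed
  ultimately show "\<exists>w. annihilates n w (G *\<^sub>v \<psi>) \<and> (\<exists>\<mu>\<in>?I. w \<mu> \<noteq> 0) \<and> (\<forall>g\<in>F. dot n g w = 0)"
    by blast
qed

text \<open>The commutant of \<open>D\<close> is closed under all algebra operations. Membership in
  the carrier is proved along with it, since the matrix laws used in the induction need the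
  dimensions.\<close>

lemma generated_algebra_commute:
  assumes S: "\<And>A. A \<in> S \<Longrightarrow> A \<in> carrier_mat d d \<and> D * A = A * D" and D: "D \<in> carrier_mat d d"
    and A: "A \<in> generated_algebra d S"
  shows "A \<in> carrier_mat d d \<and> D * A = A * D"
  using A
proof induction
  case one
  then show ?case using D by simp
next
  case (gen A)
  then show ?case using S by blast
next
  case (add A B)
  then show ?case
    using mult_add_distrib_mat [OF D, of A d B] add_mult_distrib_mat [of A d d B D d] D by auto
next
  case (smult A c)
  then show ?case
    using mult_smult_distrib [OF D, of A d c] mult_smult_assoc_mat [of A d d D d c] D by auto
next
  case (mult A B)
  then have A: "A \<in> carrier_mat d d" and B: "B \<in> carrier_mat d d"
    and DA: "D * A = A * D" and DB: "D * B = B * D" by auto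
  have "D * (A * B) = A * D * B" using assoc_mult_mat [OF D A B] DA by simp
  also have "\<dots> = A * (D * B)" by (rule assoc_mult_mat [OF A D B])
  also have "\<dots> = A * B * D" unfolding DB using assoc_mult_mat [OF A B D] by simp
  finally show ?case using A B by auto
qed

lemma minus_one_mult_mult:
  fixes A B :: "complex mat"
  assumes "A \<in> carrier_mat d d" "B \<in> carrier_mat d d"
  shows "((- 1) \<cdot>\<^sub>m A) * B = (- 1) \<cdot>\<^sub>m (A * B)" "A * ((- 1) \<cdot>\<^sub>m B) = (- 1) \<cdot>\<^sub>m (A * B)"
  by (rule mult_smult_assoc_mat [OF assms], rule mult_smult_distrib [OF assms])

text \<open>A combination avoiding \<open>\<gamma>\<^sub>\<mu>\<close> anticommutes with it; multiplying by the parity operator turns this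
  into a commutation relation, which passes to the generated algebra and its exponentials.\<close>

lemma parity_maj_comb_commute:
  assumes \<mu>: "\<mu> \<in> {1..2 * n}" and w: "w \<mu> = 0"
  shows "parity_op n * maj_comb n w * majorana n \<mu> = majorana n \<mu> * (parity_op n * maj_comb n w)"
proof -
  let ?P = "parity_op n" and ?W = "maj_comb n w" and ?M = "majorana n \<mu>" and ?d = "(2 :: nat) ^ n"
  note M = majorana_carrier [OF \<mu>] and P = parity_carrier [of n] and W = maj_comb_carrier [of n w]
  have "?W * ?M + ?M * ?W = (2 * 0) \<cdot>\<^sub>m 1\<^sub>m ?d"
    using maj_comb_anticommute [of n w "\<lambda>\<nu>. if \<nu> = \<mu> then 1 else 0"]
    unfolding maj_comb_single [OF \<mu>] dot_single [OF \<mu>] w .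
  then have "?W * ?M = (2 * 0) \<cdot>\<^sub>m 1\<^sub>m ?d + (- 1) \<cdot>\<^sub>m (?M * ?W)"
    by (rule add_smult_mat_eq [where d = ?d]) (use M W in auto)
  also have "\<dots> = (- 1) \<cdot>\<^sub>m (?M * ?W)"
    by (rule eq_matI) (use M W in \<open>auto simp del: index_mult_mat(1)\<close>)
  finally have WM: "?W * ?M = (- 1) \<cdot>\<^sub>m (?M * ?W)" .
  have "?P * ?W * ?M = ?P * ((- 1) \<cdot>\<^sub>m (?M * ?W))"
    using assoc_mult_mat [OF P W M] WM by simp
  also have "\<dots> = (- 1) \<cdot>\<^sub>m (?P * ?M * ?W)"
    using minus_one_mult_mult(2) [OF P mult_carrier_mat [OF M W]] assoc_mult_mat [OF P M W] by simp
  also have "\<dots> = (- 1) \<cdot>\<^sub>m ((- 1) \<cdot>\<^sub>m (?M * ?P * ?W))"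
    using minus_one_mult_mult(1) [OF mult_carrier_mat [OF M P] W] parity_majorana [OF \<mu>] by simp
  also have "\<dots> = ?M * (?P * ?W)"
    using assoc_mult_mat [OF M P W] by (simp add: smult_minus_one_twice)
  finally show ?thesis .
qed

text \<open>Parity times \<open>maj_comb n w\<close> commutes with the gate, so it kills the new
  state as well; parity is its own inverse and cancels.\<close>

lemma annihilates_mat_exp:
  assumes M: "M \<subseteq> {1..2 * n}" and H: "H \<in> generated_algebra (2 ^ n) (majorana n ` M)"
    and w: "\<And>\<mu>. \<mu> \<in> M \<Longrightarrow> w \<mu> = 0" and \<psi>: "\<psi> \<in> carrier_vec (2 ^ n)" and ann: "annihilates n w \<psi>"
  shows "annihilates n w (mat_exp (c \<cdot>\<^sub>m H) *\<^sub>v \<psi>)"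
proof -
  let ?P = "parity_op n" and ?W = "maj_comb n w" and ?E = "mat_exp (c \<cdot>\<^sub>m H)"
  note P = parity_carrier [of n] and W = maj_comb_carrier [of n w]
  have PW: "?P * ?W \<in> carrier_mat (2 ^ n) (2 ^ n)" using P W by (rule mult_carrier_mat)
  have "c \<cdot>\<^sub>m H \<in> generated_algebra (2 ^ n) (majorana n ` M)"
    using H by (rule generated_algebra.smult)
  moreover have "A \<in> carrier_mat (2 ^ n) (2 ^ n) \<and> ?P * ?W * A = A * (?P * ?W)"
    if "A \<in> majorana n ` M" for A
    using that M w by (auto intro!: majorana_carrier parity_maj_comb_commute simp del: atLeastAtMost_iff)
  ultimately have cH: "c \<cdot>\<^sub>m H \<in> carrier_mat (2 ^ n) (2 ^ n)"
    "?P * ?W * (c \<cdot>\<^sub>m H) = (c \<cdot>\<^sub>m H) * (?P * ?W)"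
    using generated_algebra_commute [where S = "majorana n ` M", OF _ PW] by blast+
  have E: "?E \<in> carrier_mat (2 ^ n) (2 ^ n)" using cH(1) by simp
  have comm: "?P * ?W * ?E = ?E * (?P * ?W)" by (rule mat_exp_commute [OF cH(1) PW cH(2)])
  have "?W = ?P * (?P * ?W)"
    using assoc_mult_mat [OF P P W] left_mult_one_mat [OF W] by (simp add: parity_square)
  then have "?W *\<^sub>v (?E *\<^sub>v \<psi>) = ?P *\<^sub>v (?P * ?W *\<^sub>v (?E *\<^sub>v \<psi>))"
    using assoc_mult_mat_vec [OF P PW mult_mat_vec_carrier [OF E \<psi>]] by simp
  also have "?P * ?W *\<^sub>v (?E *\<^sub>v \<psi>) = ?E *\<^sub>v (?P *\<^sub>v (?W *\<^sub>v \<psi>))"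
    using assoc_mult_mat_vec [OF PW E \<psi>] assoc_mult_mat_vec [OF E PW \<psi>] assoc_mult_mat_vec [OF P W \<psi>] comm
    by simp
  also have "?W *\<^sub>v \<psi> = 0\<^sub>v (2 ^ n)" using ann by (simp add: annihilates_def)
  finally show ?thesis by (simp add: annihilates_def mult_zero_vec [OF P] mult_zero_vec [OF E])
qed

text \<open>Adding the coordinate functionals of M, at most \<kappa> of them, to F forces the
  witness to vanish on M, where the gate cannot disturb it.\<close>

lemma annihilator_dim_ge_local_gate:
  assumes W: "local_gate n \<kappa> W" and \<psi>: "\<psi> \<in> carrier_vec (2 ^ n)" and m: "annihilator_dim_ge n m \<psi>"
  shows "annihilator_dim_ge n (m - \<kappa>) (W *\<^sub>v \<psi>)"
  unfolding annihilator_dim_ge_def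
proof (intro allI impI)
  \<comment> \<open>Subtraction is truncated: for m at most \<kappa> no such F exists and nothing is
    claimed.\<close>
  fix F :: "(nat \<Rightarrow> complex) set" assume F: "finite F \<and> card F < m - \<kappa>"
  obtain M H where M: "M \<subseteq> {1..2 * n}" "card M \<le> \<kappa>"
    and H: "H \<in> generated_algebra (2 ^ n) (majorana n ` M)" and WH: "W = mat_exp (\<i> \<cdot>\<^sub>m H)"
    using W unfolding local_gate_def by blast
  define E where "E = (\<lambda>\<mu> \<nu>. if \<nu> = \<mu> then 1 else 0 :: complex) ` M"
  have "finite M" using M(1) by (rule finite_subset) simp
  then have E: "finite E" "card E \<le> \<kappa>"
    using card_image_le [of M] M(2) by (auto simp: E_def intro: order_trans)
  have "finite (F \<union> E)" "card (F \<union> E) < m"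
    using F E card_Un_le [of F E] by auto
  then obtain w where w: "annihilates n w \<psi>" "\<exists>\<mu>\<in>{1..2 * n}. w \<mu> \<noteq> 0" "\<forall>g\<in>F \<union> E. dot n g w = 0"
    using m unfolding annihilator_dim_ge_def by blast
  have "w \<mu> = 0" if "\<mu> \<in> M" for \<mu>
  proof -
    have "dot n (\<lambda>\<nu>. if \<nu> = \<mu> then 1 else 0) w = 0" using w(3) that by (auto simp: E_def)
    moreover have "\<mu> \<in> {1..2 * n}" using M(1) that by blast
    ultimately show ?thesis by (simp only: dot_single(2))
  qed
  then have "annihilates n w (W *\<^sub>v \<psi>)"
    unfolding WH by (intro annihilates_mat_exp [OF M(1) H] \<psi> w(1))
  then show "\<exists>w. annihilates n w (W *\<^sub>v \<psi>) \<and> (\<exists>\<mu>\<in>{1..2 * n}. w \<mu> \<noteq> 0) \<and> (\<forall>g\<in>F. dot n g w = 0)"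
    using w by blast
qed

lemma local_gate_carrier:
  assumes "local_gate n \<kappa> W"
  shows "W \<in> carrier_mat (2 ^ n) (2 ^ n)"
  using assms by (auto simp: local_gate_def hermitian_mat_def)

lemma gaussian_unitary_carrier: "gaussian_unitary n G \<Longrightarrow> G \<in> carrier_mat (2 ^ n) (2 ^ n)"
  by (simp add: gaussian_unitary_def unitary_mat_def)

lemma annihilator_dim_ge_doped_circuit:
  assumes "\<psi> \<in> carrier_vec (2 ^ n)" "annihilator_dim_ge n m \<psi>"
    "\<forall>i\<in>{0..t}. gaussian_unitary n (G i)" "\<forall>i\<in>{1..t}. local_gate n \<kappa> (W i)"
  shows "doped_circuit G W t \<in> carrier_mat (2 ^ n) (2 ^ n) \<and>
    annihilator_dim_ge n (m - \<kappa> * t) (doped_circuit G W t *\<^sub>v \<psi>)"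
  using assms(3,4)
proof (induction t)
  case 0
  then show ?case
    using assms(1,2) by (auto intro: annihilator_dim_ge_gaussian gaussian_unitary_carrier)
next
  case (Suc t)
  let ?C = "doped_circuit G W t"
  have C: "?C \<in> carrier_mat (2 ^ n) (2 ^ n)" and dim: "annihilator_dim_ge n (m - \<kappa> * t) (?C *\<^sub>v \<psi>)"
    using Suc by auto
  have G: "gaussian_unitary n (G (Suc t))" and W: "local_gate n \<kappa> (W (Suc t))"
    using Suc.prems by auto
  note G' = gaussian_unitary_carrier [OF G] and W' = local_gate_carrier [OF W]
  have C\<psi>: "?C *\<^sub>v \<psi> \<in> carrier_vec (2 ^ n)" using C assms(1) by simp
  have "annihilator_dim_ge n (m - \<kappa> * t - \<kappa>) (G (Suc t) *\<^sub>v (W (Suc t) *\<^sub>v (?C *\<^sub>v \<psi>)))"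
    by (rule annihilator_dim_ge_gaussian [OF G mult_mat_vec_carrier [OF W' C\<psi>]
          annihilator_dim_ge_local_gate [OF W C\<psi> dim]])
  also have "G (Suc t) *\<^sub>v (W (Suc t) *\<^sub>v (?C *\<^sub>v \<psi>)) = doped_circuit G W (Suc t) *\<^sub>v \<psi>"
    using assoc_mult_mat_vec [OF G' W' C\<psi>] assoc_mult_mat_vec [OF mult_carrier_mat [OF G' W'] C assms(1)]
    by simp
  finally show ?case
    using mult_carrier_mat [OF mult_carrier_mat [OF G' W'] C] by (simp add: algebra_simps)
qed

section \<open>Annihilation operators and the vacuum\<close>

text \<open>Coefficients of \<open>\<gamma>\<^bsub>2k-1\<^esub> + i \<gamma>\<^bsub>2k\<^esub>\<close>, twice the annihilation operator of mode \<open>k\<close>.\<close>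

definition lowering :: "nat \<Rightarrow> nat \<Rightarrow> complex" where
  "lowering k = (\<lambda>\<nu>. (if \<nu> = 2 * k - 1 then 1 else 0) + \<i> * (if \<nu> = 2 * k then 1 else 0))"

lemma z_string_square:
  "k \<le> Suc n \<Longrightarrow> z_string n k * z_string n k = 1\<^sub>m (2 ^ n)"
proof (induction n)
  case 0
  then have "z_string 0 k = 1\<^sub>m 1" by (auto simp: z_string_def le_Suc_eq)
  then show ?case by simp
next
  case (Suc n)
  show ?case
  proof (cases "k \<le> Suc n")
    case True
    then show ?thesis
      using Suc.IH
      by (simp add: z_string_Suc kron_mat_mult_dim kron_mat_one mult.commute [of "2 ^ n" 2])
  next
    case False
    then have "k = Suc (Suc n)" using Suc.prems by simp
    then show ?thesis using parity_square [of "Suc n"] by (simp add: parity_op_def)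
  qed
qed

lemma if_mult_if:
  "(if P then 1 else 0) * x * (if Q then 1 else 0) = (if P \<and> Q then x else (0 :: complex))"
  by simp

section \<open>Annihilation operators in the computational basis\<close>

text \<open>Qubit k is the bit \<open>i div 2 ^ (n - k) mod 2\<close> of a basis index; the higher
  and lower bits of row and column must agree.\<close>

lemma index_on_qubit:
  assumes P: "P \<in> carrier_mat 2 2" and k: "k \<in> {1..n}" and i: "i < 2 ^ n" and j: "j < 2 ^ n"
  shows "on_qubit n k P $$ (i, j) =
    (if i div 2 ^ (n - k) div 2 = j div 2 ^ (n - k) div 2 \<and> i mod 2 ^ (n - k) = j mod 2 ^ (n - k)
     then P $$ (i div 2 ^ (n - k) mod 2, j div 2 ^ (n - k) mod 2) else 0)"
proof -
  have p: "2 ^ (k - 1) * 2 * 2 ^ (n - k) = (2 :: nat) ^ n"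
    using k by (simp flip: power_add power_Suc2)
  have K: "kron_mat (1\<^sub>m (2 ^ (k - 1))) P \<in> carrier_mat (2 ^ (k - 1) * 2) (2 ^ (k - 1) * 2)"
    using P by simp
  have i': "i < 2 ^ (k - 1) * 2 * 2 ^ (n - k)" and j': "j < 2 ^ (k - 1) * 2 * 2 ^ (n - k)"
    using i j p by simp_all
  note ib = div_mod_less [OF i'] and jb = div_mod_less [OF j']
  show ?thesis
    unfolding on_qubit_def index_kron_mat [OF K one_carrier_mat i' j']
      index_kron_mat [OF one_carrier_mat P ib(1) jb(1)]
      index_one_mat(1) [OF ib(2) jb(2)]
      index_one_mat(1) [OF div_mod_less(1) [OF ib(1)] div_mod_less(1) [OF jb(1)]]
    by (rule if_mult_if)
qed

text \<open>X + iY is 2 |0><1|: the only nonzero entry is a 2 in row 0, column 1.\<close>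

definition qubit_lowering :: "complex mat" where
  "qubit_lowering = pauli_x + \<i> \<cdot>\<^sub>m pauli_y"

lemma qubit_lowering_carrier [simp]: "qubit_lowering \<in> carrier_mat 2 2"
  by (simp add: qubit_lowering_def)

text \<open>The row has bit k equal to 0, the column has it equal to 1 and agrees elsewhere; setting
  a clear bit means adding \<open>2 ^ (n - k)\<close>.\<close>

lemma index_on_qubit_lowering:
  assumes k: "k \<in> {1..n}" and i: "i < 2 ^ n" and j: "j < 2 ^ n"
  shows "on_qubit n k qubit_lowering $$ (i, j) =
    (if even (i div 2 ^ (n - k)) \<and> j = i + 2 ^ (n - k) then 2 else 0)"
proof -
  define b :: nat where "b = 2 ^ (n - k)"
  have "b > 0" by (simp add: b_def)
  have E: "qubit_lowering $$ (x mod 2, y mod 2) = (if even x \<and> odd y then 2 else 0)" for x y :: nat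
    by (cases "even x"; cases "even y")
      (simp_all add: qubit_lowering_def pauli_index odd_iff_mod_2_eq_one even_iff_mod_2_eq_zero)
  have parity: "x div 2 = y div 2 \<and> even x \<and> odd y \<longleftrightarrow> even x \<and> y = x + 1" for x y :: nat
    by presburger
  have "j div b = i div b + 1 \<and> i mod b = j mod b \<longleftrightarrow> j = i + b"
  proof
    assume *: "j div b = i div b + 1 \<and> i mod b = j mod b"
    have "j = j div b * b + j mod b" by simp
    also have "\<dots> = i div b * b + i mod b + b" using * by (simp add: distrib_right)
    finally show "j = i + b" by simp
  qed (use \<open>b > 0\<close> in simp)
  then have "i div b div 2 = j div b div 2 \<and> i mod b = j mod b \<and> even (i div b) \<and> odd (j div b) \<longleftrightarrow>
      even (i div b) \<and> j = i + b"
    using parity [of "i div b" "j div b"] by blast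
  then show ?thesis
    unfolding index_on_qubit [OF qubit_lowering_carrier k i j] E b_def [symmetric] by auto
qed

lemma on_qubit_add_smult:
  assumes k: "k \<in> {1..n}" and P: "P \<in> carrier_mat 2 2" and R: "R \<in> carrier_mat 2 2"
  shows "on_qubit n k (P + c \<cdot>\<^sub>m R) = on_qubit n k P + c \<cdot>\<^sub>m on_qubit n k R"
proof (rule eq_matI)
  note C = on_qubit_carrier [OF P k] on_qubit_carrier [OF R k]
  have PR: "P + c \<cdot>\<^sub>m R \<in> carrier_mat 2 2" using P R by simp
  fix i j assume "i < dim_row (on_qubit n k P + c \<cdot>\<^sub>m on_qubit n k R)"
    "j < dim_col (on_qubit n k P + c \<cdot>\<^sub>m on_qubit n k R)"
  then have ij: "i < 2 ^ n" "j < 2 ^ n" using C by auto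
  show "on_qubit n k (P + c \<cdot>\<^sub>m R) $$ (i, j) = (on_qubit n k P + c \<cdot>\<^sub>m on_qubit n k R) $$ (i, j)"
    using ij P R C by (simp add: index_on_qubit [OF PR k] index_on_qubit [OF P k] index_on_qubit [OF R k])
qed (use P R k in simp_all)

lemma maj_comb_lowering:
  assumes k: "k \<in> {1..n}"
  shows "maj_comb n (lowering k) = z_string n k * on_qubit n k qubit_lowering"
proof -
  have Z: "z_string n k \<in> carrier_mat (2 ^ n) (2 ^ n)" using k by (intro z_string_carrier) auto
  note X = on_qubit_carrier [OF pauli_carrier(1) k] and Y = on_qubit_carrier [OF pauli_carrier(2) k]
  have k12: "2 * k - 1 \<in> {1..2 * n}" "2 * k \<in> {1..2 * n}" "odd (2 * k - 1)" "(2 * k - 1 + 1) div 2 = k"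
    using k by auto
  have "maj_comb n (lowering k) = majorana n (2 * k - 1) + \<i> \<cdot>\<^sub>m majorana n (2 * k)"
    unfolding lowering_def maj_comb_add maj_comb_smult maj_comb_single [OF k12(1)]
      maj_comb_single [OF k12(2)] ..
  also have "majorana n (2 * k - 1) = z_string n k * on_qubit n k pauli_x"
    unfolding majorana_def Let_def k12(4) using k12(3) by simp
  also have "majorana n (2 * k) = z_string n k * on_qubit n k pauli_y"
    unfolding majorana_def Let_def by simp
  also have "\<i> \<cdot>\<^sub>m (z_string n k * on_qubit n k pauli_y) = z_string n k * (\<i> \<cdot>\<^sub>m on_qubit n k pauli_y)"
    by (rule mult_smult_distrib [OF Z Y, symmetric])
  also have "z_string n k * on_qubit n k pauli_x + \<dots> =
      z_string n k * (on_qubit n k pauli_x + \<i> \<cdot>\<^sub>m on_qubit n k pauli_y)"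
    by (rule mult_add_distrib_mat [symmetric]) (use X Y Z in auto)
  also have "on_qubit n k pauli_x + \<i> \<cdot>\<^sub>m on_qubit n k pauli_y = on_qubit n k qubit_lowering"
    unfolding qubit_lowering_def by (rule on_qubit_add_smult [symmetric]) (use k in auto)
  finally show ?thesis .
qed

lemma index_mult_mat_vec_sum:
  assumes "A \<in> carrier_mat a b" "v \<in> carrier_vec b" "i < a"
  shows "(A *\<^sub>v v) $ i = (\<Sum>k<b. A $$ (i, k) * v $ k)"
  using assms by (simp add: scalar_prod_def lessThan_atLeast0)

text \<open>The Z string squares to the identity and so drops out of the kernel condition. What
  remains moves amplitudes with bit k set to positions with bit k clear, hence it kills exactly the
  vectors without such amplitudes.\<close>

lemma annihilates_lowering_iff:
  assumes k: "k \<in> {1..n}" and \<psi>: "\<psi> \<in> carrier_vec (2 ^ n)"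
  shows "annihilates n (lowering k) \<psi> \<longleftrightarrow> (\<forall>j<2 ^ n. odd (j div 2 ^ (n - k)) \<longrightarrow> \<psi> $ j = 0)"
proof -
  let ?Z = "z_string n k" and ?L = "on_qubit n k qubit_lowering"
  define b :: nat where "b = 2 ^ (n - k)"
  have "b > 0" by (simp add: b_def)
  have Z: "?Z \<in> carrier_mat (2 ^ n) (2 ^ n)" and L: "?L \<in> carrier_mat (2 ^ n) (2 ^ n)"
    using k by (auto intro: z_string_carrier)
  have ZZ: "?Z * ?Z = 1\<^sub>m (2 ^ n)" using k by (intro z_string_square) auto
  have L\<psi>: "?L *\<^sub>v \<psi> \<in> carrier_vec (2 ^ n)" using L \<psi> by simp
  have "annihilates n (lowering k) \<psi> \<longleftrightarrow> ?Z *\<^sub>v (?L *\<^sub>v \<psi>) = 0\<^sub>v (2 ^ n)"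
    unfolding annihilates_def maj_comb_lowering [OF k] using assoc_mult_mat_vec [OF Z L \<psi>] by simp
  also have "\<dots> \<longleftrightarrow> ?L *\<^sub>v \<psi> = 0\<^sub>v (2 ^ n)"
  proof
    assume "?Z *\<^sub>v (?L *\<^sub>v \<psi>) = 0\<^sub>v (2 ^ n)"
    then have "?Z *\<^sub>v (?Z *\<^sub>v (?L *\<^sub>v \<psi>)) = 0\<^sub>v (2 ^ n)" by (simp add: mult_zero_vec [OF Z])
    then show "?L *\<^sub>v \<psi> = 0\<^sub>v (2 ^ n)" using assoc_mult_mat_vec [OF Z Z L\<psi>] L\<psi> ZZ by simp
  qed (simp add: mult_zero_vec [OF Z])
  also have "\<dots> \<longleftrightarrow> (\<forall>i<2 ^ n. (?L *\<^sub>v \<psi>) $ i = 0)"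
  proof
    assume "\<forall>i<2 ^ n. (?L *\<^sub>v \<psi>) $ i = 0"
    then show "?L *\<^sub>v \<psi> = 0\<^sub>v (2 ^ n)" using L by (intro eq_vecI) auto
  qed simp
  also have "\<dots> \<longleftrightarrow> (\<forall>j<2 ^ n. odd (j div b) \<longrightarrow> \<psi> $ j = 0)"
  proof -
    have entry: "(?L *\<^sub>v \<psi>) $ i = (if even (i div b) \<and> i + b < 2 ^ n then 2 * \<psi> $ (i + b) else 0)"
      if i: "i < 2 ^ n" for i
    proof -
      have "(?L *\<^sub>v \<psi>) $ i = (\<Sum>j<2 ^ n. if j = i + b then if even (i div b) then 2 * \<psi> $ j else 0 else 0)"
        unfolding index_mult_mat_vec_sum [OF L \<psi> i]
        by (rule sum.cong) (use i in \<open>auto simp: index_on_qubit_lowering [OF k] b_def\<close>)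
      then show ?thesis by simp
    qed
    show ?thesis
    proof
      assume 0: "\<forall>i<2 ^ n. (?L *\<^sub>v \<psi>) $ i = 0"
      show "\<forall>j<2 ^ n. odd (j div b) \<longrightarrow> \<psi> $ j = 0"
      proof (intro allI impI)
        fix j assume j: "j < 2 ^ n" "odd (j div b)"
        have "b \<le> j" using j(2) by (metis div_less even_zero not_le)
        then have "j div b = Suc ((j - b) div b)"
          using \<open>b > 0\<close> by (intro le_div_geq)
        then have "even ((j - b) div b)" using j(2) by simp
        moreover have "j - b < 2 ^ n" using j(1) by simp
        ultimately show "\<psi> $ j = 0" using 0 entry [of "j - b"] j(1) \<open>b \<le> j\<close> by simp
      qed
    next
      assume 0: "\<forall>j<2 ^ n. odd (j div b) \<longrightarrow> \<psi> $ j = 0"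
      show "\<forall>i<2 ^ n. (?L *\<^sub>v \<psi>) $ i = 0"
        using 0 \<open>b > 0\<close> by (auto simp: entry simp del: index_mult_mat_vec)
    qed
  qed
  finally show ?thesis by (simp add: b_def)
qed

lemma annihilates_zero_state:
  assumes "k \<in> {1..n}"
  shows "annihilates n (lowering k) (zero_state n)"
  by (subst annihilates_lowering_iff [OF assms]) (auto simp: zero_state_def)

lemma annihilates_sum:
  assumes "\<psi> \<in> carrier_vec (2 ^ n)" "\<And>k. k \<in> K \<Longrightarrow> annihilates n (a k) \<psi>"
  shows "annihilates n (\<lambda>\<nu>. \<Sum>k\<in>K. c k * a k \<nu>) \<psi>"
  unfolding annihilates_def
proof (rule eq_vecI)
  fix i assume "i < dim_vec (0\<^sub>v (2 ^ n) :: complex vec)"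
  then have i: "i < 2 ^ n" by simp
  have "(maj_comb n (\<lambda>\<nu>. \<Sum>k\<in>K. c k * a k \<nu>) *\<^sub>v \<psi>) $ i =
      (\<Sum>j<2 ^ n. \<Sum>k\<in>K. c k * (maj_comb n (a k) $$ (i, j) * \<psi> $ j))"
    unfolding mat_sum_maj_comb [symmetric] index_mult_mat_vec_sum [OF mat_sum_carrier assms(1) i]
    by (rule sum.cong) (use i in \<open>simp_all add: index_mat_sum sum_distrib_right mult.assoc\<close>)
  also have "\<dots> = (\<Sum>k\<in>K. c k * (maj_comb n (a k) *\<^sub>v \<psi>) $ i)"
    unfolding index_mult_mat_vec_sum [OF maj_comb_carrier assms(1) i] sum_distrib_left by (rule sum.swap)
  also have "\<dots> = 0"
    by (rule sum.neutral) (use assms(2) i in \<open>simp add: annihilates_def\<close>)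
  finally show "(maj_comb n (\<lambda>\<nu>. \<Sum>k\<in>K. c k * a k \<nu>) *\<^sub>v \<psi>) $ i = 0\<^sub>v (2 ^ n) $ i"
    using i by simp
qed simp

lemma zero_state_carrier [simp]: "zero_state n \<in> carrier_vec (2 ^ n)"
  by (simp add: zero_state_def)

text \<open>Combinations of the n lowering vectors have n free coefficients, so fewer than n linear
  conditions leave a nontrivial choice.\<close>

lemma annihilator_dim_ge_zero_state: "annihilator_dim_ge n n (zero_state n)"
  unfolding annihilator_dim_ge_def
proof (intro allI impI)
  let ?K = "{1..n}"
  fix F :: "(nat \<Rightarrow> complex) set" assume F: "finite F \<and> card F < n"
  define F' where "F' = (\<lambda>g k. dot n g (lowering k)) ` F"
  have "finite F'" "card F' < card ?K"
    using F card_image_le [of F] by (auto simp: F'_def intro: le_less_trans)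
  then obtain c where c: "\<exists>k\<in>?K. c k \<noteq> 0" "\<forall>g\<in>F'. (\<Sum>k\<in>?K. g k * c k) = 0"
    using underdetermined_system [of F' ?K] by auto
  define w where "w = (\<lambda>\<nu>. \<Sum>k\<in>?K. c k * lowering k \<nu>)"
  have "annihilates n w (zero_state n)"
    unfolding w_def by (rule annihilates_sum) (auto intro!: annihilates_zero_state)
  moreover have "\<exists>\<mu>\<in>{1..2 * n}. w \<mu> \<noteq> 0"
  proof -
    obtain k where k: "k \<in> ?K" "c k \<noteq> 0" using c(1) by blast
    \<comment> \<open>Coordinate 2 * k occurs in \<open>lowering k\<close> alone, so it recovers the
      coefficient c k up to the factor \<i>.\<close>
    have "lowering l (2 * k) = (if l = k then \<i> else 0)" if "l \<in> ?K" for l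
    proof -
      have "2 * k \<noteq> 2 * l - 1" using that by simp presburger
      then show ?thesis by (auto simp: lowering_def)
    qed
    then have "w (2 * k) = (\<Sum>l\<in>?K. if l = k then \<i> * c l else 0)"
      unfolding w_def by (intro sum.cong) auto
    also have "\<dots> = \<i> * c k" using k by simp
    finally have "w (2 * k) \<noteq> 0" using k by simp
    moreover have "2 * k \<in> {1..2 * n}" using k by auto
    ultimately show ?thesis by blast
  qed
  moreover have "dot n g w = 0" if g: "g \<in> F" for g
  proof -
    have "dot n g w = (\<Sum>\<nu>\<in>{1..2 * n}. \<Sum>k\<in>?K. g \<nu> * lowering k \<nu> * c k)"
      unfolding dot_def w_def sum_distrib_left by (intro sum.cong refl) simp
    also have "\<dots> = (\<Sum>k\<in>?K. \<Sum>\<nu>\<in>{1..2 * n}. g \<nu> * lowering k \<nu> * c k)" by (rule sum.swap)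
    also have "\<dots> = (\<Sum>k\<in>?K. dot n g (lowering k) * c k)" by (simp add: dot_def sum_distrib_right)
    also have "\<dots> = 0" using c(2) g by (auto simp: F'_def)
    finally show ?thesis .
  qed
  ultimately show "\<exists>w. annihilates n w (zero_state n) \<and> (\<exists>\<mu>\<in>{1..2 * n}. w \<mu> \<noteq> 0) \<and> (\<forall>g\<in>F. dot n g w = 0)"
    by blast
qed

lemma power_two_dvd:
  assumes "\<And>p. p < r \<Longrightarrow> even (j div 2 ^ p)"
  shows "2 ^ r dvd (j :: nat)"
  using assms
proof (induction r)
  case (Suc r)
  then obtain c where c: "j = 2 ^ r * c" by (auto simp: dvd_def)
  then have "even c" using Suc.prems [of r] by simp
  then show ?case using c by (auto elim!: evenE)
qed simp

text \<open>Amplitudes with a set bit among the last n - s vanish. The surviving indices are the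
  multiples of \<open>2 ^ (n - s)\<close>, and their amplitudes form the first tensor
  factor.\<close>

lemma annihilated_product_state:
  assumes s: "s \<le> n" and \<chi>: "\<chi> \<in> carrier_vec (2 ^ n)"
    and ann: "\<And>k. k \<in> {s + 1..n} \<Longrightarrow> annihilates n (lowering k) \<chi>"
  shows "\<chi> = kron_vec (vec (2 ^ s) (\<lambda>i. \<chi> $ (i * 2 ^ (n - s)))) (zero_state (n - s))"
proof (rule eq_vecI)
  let ?b = "(2 :: nat) ^ (n - s)"
  have dim: "2 ^ s * ?b = (2 :: nat) ^ n" using s by (simp flip: power_add)
  fix i assume "i < dim_vec (kron_vec (vec (2 ^ s) (\<lambda>i. \<chi> $ (i * ?b))) (zero_state (n - s)))"
  then have i: "i < 2 ^ s * ?b" by (simp add: kron_vec_def zero_state_def)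
  have "\<chi> $ i = (if i mod ?b = 0 then \<chi> $ (i div ?b * ?b) else 0)"
  proof (cases "i mod ?b = 0")
    case True
    then have "i div ?b * ?b = i" by (metis add.right_neutral div_mult_mod_eq)
    then show ?thesis using True by simp
  next
    case False
    \<comment> \<open>Not being a multiple of \<open>2 ^ (n - s)\<close> means that a low bit p is
      set; bit p belongs to qubit n - p.\<close>
    then obtain p where p: "p < n - s" "odd (i div 2 ^ p)"
      using power_two_dvd [of "n - s" i] by (metis dvd_imp_mod_0)
    then have k: "n - p \<in> {s + 1..n}" "n - p \<in> {1..n}" "n - (n - p) = p" by auto
    have "i < 2 ^ n" using i dim by simp
    then have "\<chi> $ i = 0"
      using ann [OF k(1)] p(2) unfolding annihilates_lowering_iff [OF k(2) \<chi>] k(3) by blast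
    then show ?thesis using False by simp
  qed
  then show "\<chi> $ i = kron_vec (vec (2 ^ s) (\<lambda>i. \<chi> $ (i * ?b))) (zero_state (n - s)) $ i"
    using i div_mod_less [OF i] by (auto simp: kron_vec_def zero_state_def)
next
  show "dim_vec \<chi> = dim_vec (kron_vec (vec (2 ^ s) (\<lambda>i. \<chi> $ (i * 2 ^ (n - s)))) (zero_state (n - s)))"
    using \<chi> s by (simp add: kron_vec_def zero_state_def flip: power_add)
qed

section \<open>Compression\<close>

lemma annihilates_cong:
  assumes "annihilates n u \<psi>" "\<And>\<nu>. \<nu> \<in> {1..2 * n} \<Longrightarrow> u \<nu> = w \<nu>"
  shows "annihilates n w \<psi>"
  using assms maj_comb_cong [of n u w] by (simp add: annihilates_def)

lemma annihilates_smult: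
  assumes "\<psi> \<in> carrier_vec (2 ^ n)" "annihilates n w \<psi>"
  shows "annihilates n (\<lambda>\<nu>. c * w \<nu>) \<psi>"
  using annihilates_sum [of \<psi> n "{()}" "\<lambda>_. w" "\<lambda>_. c"] assms by simp

text \<open>The anticommutator kills the state, yet it acts as the scalar
  \<open>2 * dot n u w\<close>; a nonzero amplitude then forces the scalar to be 0.\<close>

lemma annihilator_isotropic:
  assumes \<psi>: "\<psi> \<in> carrier_vec (2 ^ n)" "\<psi> \<noteq> 0\<^sub>v (2 ^ n)"
    and u: "annihilates n u \<psi>" and w: "annihilates n w \<psi>"
  shows "dot n u w = 0"
proof -
  let ?U = "maj_comb n u" and ?W = "maj_comb n w"
  note C = maj_comb_carrier [of n u] maj_comb_carrier [of n w]
  obtain i where i: "i < 2 ^ n" "\<psi> $ i \<noteq> 0"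
    using \<psi> by (metis carrier_vecD eq_vecI index_zero_vec)
  have "((2 * dot n u w) \<cdot>\<^sub>m 1\<^sub>m (2 ^ n)) *\<^sub>v \<psi> = (?U * ?W + ?W * ?U) *\<^sub>v \<psi>"
    by (simp only: maj_comb_anticommute)
  also have "\<dots> = ?U * ?W *\<^sub>v \<psi> + ?W * ?U *\<^sub>v \<psi>"
    by (rule add_mult_distrib_mat_vec [OF mult_carrier_mat [OF C] mult_carrier_mat [OF C(2,1)] \<psi>(1)])
  also have "\<dots> = 0\<^sub>v (2 ^ n)"
    using u w assoc_mult_mat_vec [OF C \<psi>(1)] assoc_mult_mat_vec [OF C(2,1) \<psi>(1)]
    by (simp add: annihilates_def mult_zero_vec)
  also have "((2 * dot n u w) \<cdot>\<^sub>m 1\<^sub>m (2 ^ n)) *\<^sub>v \<psi> = (2 * dot n u w) \<cdot>\<^sub>v \<psi>"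
    by (rule eq_vecI) (use \<psi>(1) in \<open>auto simp: smult_scalar_prod_distrib [of _ "2 ^ n"]\<close>)
  finally have "((2 * dot n u w) \<cdot>\<^sub>v \<psi>) $ i = 0" using i by simp
  then show ?thesis using i \<psi>(1) by simp
qed

text \<open>V Z V kills V applied to \<chi> because V squares to the identity. Conjugation gives
  minus the reflection, and the sign is removed by rescaling, so a genuine reflection
  remains.\<close>

lemma annihilates_reflection:
  assumes v: "dot n v v = 1" and \<chi>: "\<chi> \<in> carrier_vec (2 ^ n)" and z: "annihilates n z \<chi>"
  shows "annihilates n (\<lambda>\<nu>. z \<nu> - 2 * dot n v z * v \<nu>) (maj_comb n v *\<^sub>v \<chi>)"
proof -
  let ?V = "maj_comb n v" and ?Z = "maj_comb n z"
  note V = maj_comb_carrier [of n v] and Z = maj_comb_carrier [of n z]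
  have VV: "?V * ?V = 1\<^sub>m (2 ^ n)"
    using v by (simp add: maj_comb_square) (rule eq_matI; simp)
  have V\<chi>: "?V *\<^sub>v \<chi> \<in> carrier_vec (2 ^ n)" using V \<chi> by (rule mult_mat_vec_carrier)
  have "?V * ?Z * ?V *\<^sub>v (?V *\<^sub>v \<chi>) = ?V *\<^sub>v (?Z *\<^sub>v (?V * ?V *\<^sub>v \<chi>))"
    using assoc_mult_mat_vec [OF mult_carrier_mat [OF V Z] V V\<chi>]
      assoc_mult_mat_vec [OF V Z mult_mat_vec_carrier [OF V V\<chi>]] assoc_mult_mat_vec [OF V V \<chi>] by simp
  also have "\<dots> = 0\<^sub>v (2 ^ n)" using z \<chi> by (simp add: VV annihilates_def mult_zero_vec [OF V])
  finally have "annihilates n (\<lambda>\<nu>. 2 * dot n v z * v \<nu> - z \<nu>) (?V *\<^sub>v \<chi>)"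
    by (simp add: annihilates_def maj_comb_conj [OF v])
  from annihilates_smult [OF V\<chi> this, of "- 1"] show ?thesis by simp
qed

text \<open>The Householder reflection in \<open>v\<close> moves the real unit vector \<open>x\<close> to the basis vector \<open>p\<close>;
  the case \<open>v = 0\<close> covers the situation where \<open>x\<close> is already that basis vector.\<close>

lemma householder_gaussian:
  fixes x :: "nat \<Rightarrow> real"
  assumes x: "(\<Sum>\<nu>\<in>{1..2 * n}. x \<nu> * x \<nu>) = 1" and p: "p \<in> {1..2 * n}"
    and \<chi>: "\<chi> \<in> carrier_vec (2 ^ n)"
  obtains U c \<chi>' v where "gaussian_unitary n U" "\<chi>' \<in> carrier_vec (2 ^ n)" "\<chi> = U *\<^sub>v \<chi>'" "\<chi>' = U *\<^sub>v \<chi>"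
    "v = (\<lambda>\<nu>. c * (x \<nu> - (if \<nu> = p then 1 else 0)))"
    "\<forall>\<nu>\<in>{1..2 * n}.
      x \<nu> - 2 * (\<Sum>\<nu>\<in>{1..2 * n}. v \<nu> * x \<nu>) * v \<nu> = (if \<nu> = p then 1 else 0)"
    "\<forall>z. annihilates n z \<chi> \<longrightarrow>
      annihilates n (\<lambda>\<nu>. z \<nu> - 2 * dot n (\<lambda>\<nu>. complex_of_real (v \<nu>)) z * complex_of_real (v \<nu>)) \<chi>'"
proof (cases "\<forall>\<nu>\<in>{1..2 * n}. x \<nu> = (if \<nu> = p then 1 else 0)")
  case True
  show thesis
  proof (rule that)
    show "gaussian_unitary n (1\<^sub>m (2 ^ n))" by (rule gaussian_unitary_one)
    show "(\<lambda>_. 0) = (\<lambda>\<nu>. 0 * (x \<nu> - (if \<nu> = p then 1 else 0)))" by simp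
  qed (use True \<chi> in auto)
next
  case False
  let ?I = "{1..2 * n}"
  let ?d = "\<lambda>\<nu>. if \<nu> = p then 1 else 0 :: real"
  define N where "N = (\<Sum>\<nu>\<in>?I. (x \<nu> - ?d \<nu>) * (x \<nu> - ?d \<nu>))"
  \<comment> \<open>Normalises x minus the target basis vector, the classical Householder
    direction.\<close>
  define c where "c = 1 / sqrt N"
  define v where "v = (\<lambda>\<nu>. c * (x \<nu> - ?d \<nu>))"
  have "N \<noteq> 0"
  proof
    assume "N = 0"
    then have "\<forall>\<nu>\<in>?I. (x \<nu> - ?d \<nu>) * (x \<nu> - ?d \<nu>) = 0"
      unfolding N_def by (subst (asm) sum_nonneg_eq_0_iff) auto
    then show False using False by auto
  qed
  moreover have "N \<ge> 0" unfolding N_def by (intro sum_nonneg) simp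
  ultimately have "N > 0" by simp
  then have c2: "c * c * N = 1" by (simp add: c_def)
  have xp: "(\<Sum>\<nu>\<in>?I. ?d \<nu> * x \<nu>) = x p"
  proof -
    have "(\<Sum>\<nu>\<in>?I. ?d \<nu> * x \<nu>) = (\<Sum>\<nu>\<in>?I. if \<nu> = p then x \<nu> else 0)"
      by (rule sum.cong) simp_all
    then show ?thesis using p by simp
  qed
  \<comment> \<open>Both x and the basis vector have unit length, so only the cross term depends on
    x.\<close>
  have "N = (\<Sum>\<nu>\<in>?I. x \<nu> * x \<nu> - 2 * (?d \<nu> * x \<nu>) + ?d \<nu>)"
    unfolding N_def by (rule sum.cong) (auto simp: algebra_simps)
  also have "\<dots> = 2 - 2 * x p"
    using p x xp by (simp only: sum.distrib sum_subtractf flip: sum_distrib_left) simp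
  finally have N: "N = 2 - 2 * x p" .
  have vv: "(\<Sum>\<nu>\<in>?I. v \<nu> * v \<nu>) = 1"
  proof -
    have "(\<Sum>\<nu>\<in>?I. v \<nu> * v \<nu>) = c * c * N"
      unfolding N_def v_def sum_distrib_left by (intro sum.cong refl) (simp add: mult_ac)
    then show ?thesis using c2 by simp
  qed
  have vx: "(\<Sum>\<nu>\<in>?I. v \<nu> * x \<nu>) = c * (1 - x p)"
  proof -
    have "(\<Sum>\<nu>\<in>?I. v \<nu> * x \<nu>) = c * (\<Sum>\<nu>\<in>?I. x \<nu> * x \<nu> - ?d \<nu> * x \<nu>)"
      unfolding v_def sum_distrib_left by (intro sum.cong refl) (simp add: algebra_simps)
    then show ?thesis using x xp by (simp only: sum_subtractf)
  qed
  let ?V = "maj_comb n (\<lambda>\<nu>. complex_of_real (v \<nu>))"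
  have dv: "dot n (\<lambda>\<nu>. complex_of_real (v \<nu>)) (\<lambda>\<nu>. complex_of_real (v \<nu>)) = 1"
    using arg_cong [OF vv, of complex_of_real] by (simp add: dot_def)
  have VV: "?V * ?V = 1\<^sub>m (2 ^ n)"
    using dv by (simp add: maj_comb_square) (rule eq_matI; simp)
  show thesis
  proof (rule that)
    show "gaussian_unitary n ?V" by (rule gaussian_unitary_maj_comb [OF vv])
    show "?V *\<^sub>v \<chi> \<in> carrier_vec (2 ^ n)" by (rule mult_mat_vec_carrier [OF maj_comb_carrier \<chi>])
    show "\<chi> = ?V *\<^sub>v (?V *\<^sub>v \<chi>)"
      using assoc_mult_mat_vec [OF maj_comb_carrier maj_comb_carrier \<chi>] VV \<chi> by (metis one_mult_mat_vec)
    show "v = (\<lambda>\<nu>. c * (x \<nu> - ?d \<nu>))" by (rule v_def)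
    show "\<forall>\<nu>\<in>?I. x \<nu> - 2 * (\<Sum>\<nu>\<in>?I. v \<nu> * x \<nu>) * v \<nu> = ?d \<nu>"
    proof
      fix \<nu>
      have "2 * (c * (1 - x p)) * v \<nu> = c * c * N * (x \<nu> - ?d \<nu>)"
        unfolding N v_def by (simp add: algebra_simps)
      then show "x \<nu> - 2 * (\<Sum>\<nu>\<in>?I. v \<nu> * x \<nu>) * v \<nu> = ?d \<nu>" unfolding vx c2 by simp
    qed
  qed (use annihilates_reflection [OF dv \<chi>] in auto)
qed

lemma dot_lowering:
  assumes "j \<in> {1..n}"
  shows "dot n w (lowering j) = w (2 * j - 1) + \<i> * w (2 * j)"
    "dot n (\<lambda>\<nu>. cnj (lowering j \<nu>)) w = w (2 * j - 1) - \<i> * w (2 * j)"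
proof -
  have j: "2 * j - 1 \<in> {1..2 * n}" "2 * j \<in> {1..2 * n}" using assms by auto
  have "dot n w (lowering j) = dot n w (\<lambda>\<nu>. if \<nu> = 2 * j - 1 then 1 else 0) +
      \<i> * dot n w (\<lambda>\<nu>. if \<nu> = 2 * j then 1 else 0)"
    unfolding dot_def lowering_def by (simp add: distrib_left sum.distrib sum_distrib_left mult_ac)
  then show "dot n w (lowering j) = w (2 * j - 1) + \<i> * w (2 * j)"
    unfolding dot_single [OF j(1)] dot_single [OF j(2)] .
  have "dot n (\<lambda>\<nu>. cnj (lowering j \<nu>)) w = (\<Sum>\<nu>\<in>{1..2 * n}.
      (if \<nu> = 2 * j - 1 then 1 else 0) * w \<nu> - \<i> * ((if \<nu> = 2 * j then 1 else 0) * w \<nu>))"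
    unfolding dot_def lowering_def by (rule sum.cong) (simp_all add: algebra_simps)
  also have "\<dots> = dot n (\<lambda>\<nu>. if \<nu> = 2 * j - 1 then 1 else 0) w -
      \<i> * dot n (\<lambda>\<nu>. if \<nu> = 2 * j then 1 else 0) w"
    unfolding dot_def by (simp only: sum_subtractf sum_distrib_left)
  finally show "dot n (\<lambda>\<nu>. cnj (lowering j \<nu>)) w = w (2 * j - 1) - \<i> * w (2 * j)"
    unfolding dot_single [OF j(1)] dot_single [OF j(2)] .
qed

text \<open>Splits the form over real and imaginary parts: for an isotropic w the real component
  gives equal lengths, the imaginary one orthogonality.\<close>

lemma dot_complex:
  fixes x y :: "nat \<Rightarrow> real"
  assumes "\<And>\<nu>. \<nu> \<in> {1..2 * n} \<Longrightarrow> w \<nu> = complex_of_real (x \<nu>) + \<i> * complex_of_real (y \<nu>)"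
  shows "dot n w w = Complex ((\<Sum>\<nu>\<in>{1..2 * n}. x \<nu> * x \<nu>) - (\<Sum>\<nu>\<in>{1..2 * n}. y \<nu> * y \<nu>))
      (2 * (\<Sum>\<nu>\<in>{1..2 * n}. x \<nu> * y \<nu>))"
    "dot n (\<lambda>\<nu>. complex_of_real (v \<nu>)) w =
      complex_of_real (\<Sum>\<nu>\<in>{1..2 * n}. v \<nu> * x \<nu>) + \<i> * complex_of_real (\<Sum>\<nu>\<in>{1..2 * n}. v \<nu> * y \<nu>)"
proof -
  have "dot n w w = (\<Sum>\<nu>\<in>{1..2 * n}. Complex (x \<nu> * x \<nu> - y \<nu> * y \<nu>) (2 * (x \<nu> * y \<nu>)))"
    unfolding dot_def by (rule sum.cong) (simp_all add: assms complex_eq_iff)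
  then show "dot n w w = Complex ((\<Sum>\<nu>\<in>{1..2 * n}. x \<nu> * x \<nu>) - (\<Sum>\<nu>\<in>{1..2 * n}. y \<nu> * y \<nu>))
      (2 * (\<Sum>\<nu>\<in>{1..2 * n}. x \<nu> * y \<nu>))"
    by (simp add: complex_eq_iff sum_subtractf sum_distrib_left)
  have "dot n (\<lambda>\<nu>. complex_of_real (v \<nu>)) w = (\<Sum>\<nu>\<in>{1..2 * n}. Complex (v \<nu> * x \<nu>) (v \<nu> * y \<nu>))"
    unfolding dot_def by (rule sum.cong) (simp_all add: assms complex_eq_iff)
  then show "dot n (\<lambda>\<nu>. complex_of_real (v \<nu>)) w =
      complex_of_real (\<Sum>\<nu>\<in>{1..2 * n}. v \<nu> * x \<nu>) + \<i> * complex_of_real (\<Sum>\<nu>\<in>{1..2 * n}. v \<nu> * y \<nu>)"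
    by (simp add: complex_eq_iff)
qed

section \<open>Clearing modes one at a time\<close>

text \<open>One reflection sends the real part of a suitable annihilating vector to basis vector 2 *
  k - 1, a second sends the imaginary part to 2 * k. The n - k conditions on the vector, one for
  each cleared mode, account for the hypothesis n - k < m.\<close>

lemma clear_mode:
  assumes k: "k \<in> {1..n}" and m: "n - k < m"
    and \<chi>: "\<chi> \<in> carrier_vec (2 ^ n)" "\<chi> \<noteq> 0\<^sub>v (2 ^ n)" and dim: "annihilator_dim_ge n m \<chi>"
    and ann: "\<And>j. j \<in> {k + 1..n} \<Longrightarrow> annihilates n (lowering j) \<chi>"
  shows "\<exists>G \<chi>'. gaussian_unitary n G \<and> \<chi>' \<in> carrier_vec (2 ^ n) \<and> \<chi> = G *\<^sub>v \<chi>' \<and>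
    annihilator_dim_ge n m \<chi>' \<and> (\<forall>j\<in>{k..n}. annihilates n (lowering j) \<chi>')"
proof -
  let ?I = "{1..2 * n}"
  \<comment> \<open>The conjugates are imposed as conditions; the product with the lowering vectors
    themselves vanishes by isotropy.\<close>
  define F where "F = (\<lambda>j \<nu>. cnj (lowering j \<nu>)) ` {k + 1..n}"
  have "finite F" by (simp add: F_def)
  moreover have "card F < m"
    using card_image_le [of "{k + 1..n}" "\<lambda>j \<nu>. cnj (lowering j \<nu>)"] m by (simp add: F_def)
  ultimately obtain w where w: "annihilates n w \<chi>" "\<exists>\<mu>\<in>?I. w \<mu> \<noteq> 0" "\<forall>g\<in>F. dot n g w = 0"
    using dim unfolding annihilator_dim_ge_def by blast
  have w0: "w (2 * j - 1) = 0" "w (2 * j) = 0" if j: "j \<in> {k + 1..n}" for j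
  proof -
    have j': "j \<in> {1..n}" using j k by auto
    have "w (2 * j - 1) + \<i> * w (2 * j) = 0"
      using annihilator_isotropic [OF \<chi> w(1) ann [OF j]] unfolding dot_lowering(1) [OF j'] .
    moreover have "w (2 * j - 1) - \<i> * w (2 * j) = 0"
      using w(3) j unfolding dot_lowering(2) [OF j', symmetric] by (auto simp: F_def)
    moreover have "2 * a = (a + b) + (a - b)" "2 * b = (a + b) - (a - b)" for a b :: complex
      by simp_all
    ultimately have "2 * w (2 * j - 1) = 0" "2 * (\<i> * w (2 * j)) = 0" by (metis add_0 diff_0_right)+
    then show "w (2 * j - 1) = 0" "w (2 * j) = 0" by simp_all
  qed
  define N where "N = (\<Sum>\<nu>\<in>?I. Re (w \<nu>) * Re (w \<nu>))"
  define x where "x \<nu> = Re (w \<nu>) / sqrt N" for \<nu>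
  define y where "y \<nu> = Im (w \<nu>) / sqrt N" for \<nu>
  \<comment> \<open>By isotropy a vanishing real part would force a vanishing imaginary part, but w
    is nonzero.\<close>
  have "N \<noteq> 0"
  proof
    assume 0: "N = 0"
    have wc: "w \<nu> = complex_of_real (Re (w \<nu>)) + \<i> * complex_of_real (Im (w \<nu>))" for \<nu>
      by (rule complex_eq)
    have "(\<Sum>\<nu>\<in>?I. Im (w \<nu>) * Im (w \<nu>)) = 0"
      using annihilator_isotropic [OF \<chi> w(1) w(1)] 0 dot_complex(1) [OF wc, of n] by (simp add: N_def complex_eq_iff)
    then have "\<forall>\<nu>\<in>?I. Im (w \<nu>) * Im (w \<nu>) = 0"
      by (subst (asm) sum_nonneg_eq_0_iff) auto
    moreover have "\<forall>\<nu>\<in>?I. Re (w \<nu>) * Re (w \<nu>) = 0"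
      using 0 unfolding N_def by (subst (asm) sum_nonneg_eq_0_iff) auto
    ultimately show False using w(2) by (auto simp: complex_eq_iff)
  qed
  moreover have "N \<ge> 0" unfolding N_def by (intro sum_nonneg) simp
  ultimately have "N > 0" by simp
  then have xx: "(\<Sum>\<nu>\<in>?I. x \<nu> * x \<nu>) = 1"
    by (simp add: x_def N_def flip: sum_divide_distrib)
  have xy0: "x (2 * j - 1) = 0" "x (2 * j) = 0" "y (2 * j - 1) = 0" "y (2 * j) = 0" if "j \<in> {k + 1..n}" for j
    using w0 [OF that] by (simp_all add: x_def y_def)
  define w1 where "w1 \<nu> = complex_of_real (x \<nu>) + \<i> * complex_of_real (y \<nu>)" for \<nu>
  have w1_eq: "w1 = (\<lambda>\<nu>. complex_of_real (1 / sqrt N) * w \<nu>)"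
    by (rule ext) (simp add: w1_def x_def y_def complex_eq_iff)
  have w1: "annihilates n w1 \<chi>"
    unfolding w1_eq by (rule annihilates_smult [OF \<chi>(1) w(1)])
  have p: "2 * k - 1 \<in> ?I" "2 * k \<in> ?I" using k by auto
  have ne: "2 * j - 1 \<noteq> 2 * k - 1" "2 * j \<noteq> 2 * k - 1" "2 * j - 1 \<noteq> 2 * k" "2 * j \<noteq> 2 * k"
    if "j \<in> {k + 1..n}" for j
  proof -
    have "1 \<le> k" "k < j" using that k by auto
    then show "2 * j - 1 \<noteq> 2 * k - 1" "2 * j \<noteq> 2 * k - 1" "2 * j - 1 \<noteq> 2 * k" "2 * j \<noteq> 2 * k"
      by presburger+
  qed
  obtain U1 c1 \<chi>1 v1 where U1: "gaussian_unitary n U1" and \<chi>1: "\<chi>1 \<in> carrier_vec (2 ^ n)" "\<chi> = U1 *\<^sub>v \<chi>1" "\<chi>1 = U1 *\<^sub>v \<chi>"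
    and v1: "v1 = (\<lambda>\<nu>. c1 * (x \<nu> - (if \<nu> = 2 * k - 1 then 1 else 0)))"
    and rx_all: "\<forall>\<nu>\<in>?I. x \<nu> - 2 * (\<Sum>\<nu>\<in>?I. v1 \<nu> * x \<nu>) * v1 \<nu> = (if \<nu> = 2 * k - 1 then 1 else 0)"
    and R1_all: "\<forall>z. annihilates n z \<chi> \<longrightarrow>
      annihilates n (\<lambda>\<nu>. z \<nu> - 2 * dot n (\<lambda>\<nu>. complex_of_real (v1 \<nu>)) z * complex_of_real (v1 \<nu>)) \<chi>1"
    by (rule householder_gaussian [OF xx p(1) \<chi>(1)]) (rule that)
  note rx = rx_all [rule_format] and R1 = R1_all [rule_format]
  \<comment> \<open>The explicit form of the reflection vector shows that it vanishes on the cleared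
    modes, so their lowering vectors are fixed.\<close>
  have v10: "v1 (2 * j - 1) = 0" "v1 (2 * j) = 0" if "j \<in> {k + 1..n}" for j
    using xy0 [OF that] ne [OF that] by (simp_all add: v1)
  have ann1: "annihilates n (lowering j) \<chi>1" if j: "j \<in> {k + 1..n}" for j
    using R1 [OF ann [OF j]] dot_lowering(1) [of j n "\<lambda>\<nu>. complex_of_real (v1 \<nu>)"] v10 [OF j] j by simp
  have \<chi>1_0: "\<chi>1 \<noteq> 0\<^sub>v (2 ^ n)"
    using \<chi>(2) \<chi>1(2) mult_zero_vec [OF gaussian_unitary_carrier [OF U1]] by auto
  define y' where "y' \<nu> = y \<nu> - 2 * (\<Sum>\<nu>\<in>?I. v1 \<nu> * y \<nu>) * v1 \<nu>" for \<nu>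
  \<comment> \<open>The image of w1 under the first reflection, with its real part already in
    place.\<close>
  define w2 where "w2 \<nu> = complex_of_real (if \<nu> = 2 * k - 1 then 1 else 0) + \<i> * complex_of_real (y' \<nu>)" for \<nu>
  have w2: "annihilates n w2 \<chi>1"
  proof (rule annihilates_cong [OF R1 [OF w1]])
    fix \<nu> assume \<nu>: "\<nu> \<in> ?I"
    show "w1 \<nu> - 2 * dot n (\<lambda>\<nu>. complex_of_real (v1 \<nu>)) w1 * complex_of_real (v1 \<nu>) = w2 \<nu>"
      unfolding dot_complex(2) [OF w1_def] w2_def rx [OF \<nu>, symmetric] y'_def w1_def
      by (simp add: algebra_simps)
  qed
  have iso: "dot n w2 w2 = 0" by (rule annihilator_isotropic [OF \<chi>1(1) \<chi>1_0 w2 w2])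
  have sums: "(\<Sum>\<nu>\<in>?I. (if \<nu> = 2 * k - 1 then 1 else 0 :: real) * f \<nu>) = f (2 * k - 1)" for f
  proof -
    have "(\<Sum>\<nu>\<in>?I. (if \<nu> = 2 * k - 1 then 1 else 0) * f \<nu>) = (\<Sum>\<nu>\<in>?I. if \<nu> = 2 * k - 1 then f \<nu> else 0)"
      by (rule sum.cong) simp_all
    then show ?thesis using p(1) by simp
  qed
  \<comment> \<open>Isotropy of w2 against a real part that is now a basis vector: y' has unit
    length and vanishes at 2 * k - 1.\<close>
  have yy: "(\<Sum>\<nu>\<in>?I. y' \<nu> * y' \<nu>) = 1" and yp: "y' (2 * k - 1) = 0"
    using iso unfolding dot_complex(1) [OF w2_def] sums by (simp_all add: complex_eq_iff)
  have y'0: "y' (2 * j - 1) = 0" "y' (2 * j) = 0" if "j \<in> {k + 1..n}" for j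
    using xy0 [OF that] v10 [OF that] by (simp_all add: y'_def)
  obtain U2 c2 \<chi>2 v2 where U2: "gaussian_unitary n U2" and \<chi>2: "\<chi>2 \<in> carrier_vec (2 ^ n)" "\<chi>1 = U2 *\<^sub>v \<chi>2" "\<chi>2 = U2 *\<^sub>v \<chi>1"
    and v2: "v2 = (\<lambda>\<nu>. c2 * (y' \<nu> - (if \<nu> = 2 * k then 1 else 0)))"
    and ry_all: "\<forall>\<nu>\<in>?I. y' \<nu> - 2 * (\<Sum>\<nu>\<in>?I. v2 \<nu> * y' \<nu>) * v2 \<nu> = (if \<nu> = 2 * k then 1 else 0)"
    and R2_all: "\<forall>z. annihilates n z \<chi>1 \<longrightarrow>
      annihilates n (\<lambda>\<nu>. z \<nu> - 2 * dot n (\<lambda>\<nu>. complex_of_real (v2 \<nu>)) z * complex_of_real (v2 \<nu>)) \<chi>2"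
    by (rule householder_gaussian [OF yy p(2) \<chi>1(1)]) (rule that)
  note ry = ry_all [rule_format] and R2 = R2_all [rule_format]
  have v20: "v2 (2 * j - 1) = 0" "v2 (2 * j) = 0" if "j \<in> {k + 1..n}" for j
    using y'0 [OF that] ne [OF that] by (simp_all add: v2)
  have "2 * k - 1 \<noteq> 2 * k" using k by auto
  \<comment> \<open>Hence the second reflection leaves the real part where the first one put
    it.\<close>
  then have v2p: "v2 (2 * k - 1) = 0" using yp by (simp add: v2)
  have ann2: "annihilates n (lowering j) \<chi>2" if j: "j \<in> {k + 1..n}" for j
    using R2 [OF ann1 [OF j]] dot_lowering(1) [of j n "\<lambda>\<nu>. complex_of_real (v2 \<nu>)"] v20 [OF j] j by simp
  have "annihilates n (lowering k) \<chi>2"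
  proof (rule annihilates_cong [OF R2 [OF w2]])
    fix \<nu> assume \<nu>: "\<nu> \<in> ?I"
    have "(\<Sum>\<nu>\<in>?I. v2 \<nu> * (if \<nu> = 2 * k - 1 then 1 else 0)) = 0"
      using sums [of v2] v2p by (simp add: mult.commute)
    then have dot2: "dot n (\<lambda>\<nu>. complex_of_real (v2 \<nu>)) w2 = \<i> * complex_of_real (\<Sum>\<nu>\<in>?I. v2 \<nu> * y' \<nu>)"
      unfolding dot_complex(2) [OF w2_def] by simp
    have "lowering k \<nu> = complex_of_real (if \<nu> = 2 * k - 1 then 1 else 0) +
        \<i> * complex_of_real (if \<nu> = 2 * k then 1 else 0)"
      by (simp add: lowering_def)
    then show "w2 \<nu> - 2 * dot n (\<lambda>\<nu>. complex_of_real (v2 \<nu>)) w2 * complex_of_real (v2 \<nu>) = lowering k \<nu>"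
      unfolding dot2 ry [OF \<nu>, symmetric] w2_def by (simp add: algebra_simps)
  qed
  then have "\<forall>j\<in>insert k {k + 1..n}. annihilates n (lowering j) \<chi>2" using ann2 by blast
  moreover have "insert k {k + 1..n} = {k..n}" using k by auto
  ultimately have "\<forall>j\<in>{k..n}. annihilates n (lowering j) \<chi>2" by (simp only:)
  moreover have "annihilator_dim_ge n m \<chi>2"
    unfolding \<chi>2(3) using U2 \<chi>1(1)
    by (rule annihilator_dim_ge_gaussian) (use annihilator_dim_ge_gaussian [OF U1 \<chi>(1) dim] \<chi>1(3) in simp)
  moreover have "\<chi> = U1 * U2 *\<^sub>v \<chi>2"
    using assoc_mult_mat_vec [OF gaussian_unitary_carrier [OF U1] gaussian_unitary_carrier [OF U2] \<chi>2(1)]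
      \<chi>1(2) \<chi>2(2) by simp
  ultimately show ?thesis
    using gaussian_unitary_mult [OF U1 U2] \<chi>2(1) by blast
qed

text \<open>Modes are cleared from the last qubit downwards. The annihilator keeps its dimension m
  under Gaussian unitaries, so r < m allows mode n - r to be cleared after r others.\<close>

lemma clear_modes:
  assumes \<psi>: "\<psi> \<in> carrier_vec (2 ^ n)" "\<psi> \<noteq> 0\<^sub>v (2 ^ n)" and dim: "annihilator_dim_ge n m \<psi>"
    and r: "r \<le> m" "r \<le> n"
  shows "\<exists>G \<chi>. gaussian_unitary n G \<and> \<chi> \<in> carrier_vec (2 ^ n) \<and> \<psi> = G *\<^sub>v \<chi> \<and>
    annihilator_dim_ge n m \<chi> \<and> (\<forall>j\<in>{n - r + 1..n}. annihilates n (lowering j) \<chi>)"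
  using r
proof (induction r)
  case 0
  show ?case
    by (rule exI [of _ "1\<^sub>m (2 ^ n)"], rule exI [of _ \<psi>]) (use \<psi> dim gaussian_unitary_one in auto)
next
  case (Suc r)
  then obtain G \<chi> where G: "gaussian_unitary n G" and \<chi>: "\<chi> \<in> carrier_vec (2 ^ n)" "\<psi> = G *\<^sub>v \<chi>"
    "annihilator_dim_ge n m \<chi>" "\<forall>j\<in>{n - r + 1..n}. annihilates n (lowering j) \<chi>"
    by auto
  have "\<chi> \<noteq> 0\<^sub>v (2 ^ n)"
    using \<psi>(2) \<chi>(2) mult_zero_vec [OF gaussian_unitary_carrier [OF G]] by auto
  moreover have "n - r \<in> {1..n}" "n - (n - r) < m" using Suc.prems by auto
  ultimately obtain H \<chi>' where H: "gaussian_unitary n H" and \<chi>': "\<chi>' \<in> carrier_vec (2 ^ n)" "\<chi> = H *\<^sub>v \<chi>'"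
    "annihilator_dim_ge n m \<chi>'" "\<forall>j\<in>{n - r..n}. annihilates n (lowering j) \<chi>'"
    using clear_mode [of "n - r" n m \<chi>] \<chi> by blast
  have "\<psi> = G * H *\<^sub>v \<chi>'"
    using assoc_mult_mat_vec [OF gaussian_unitary_carrier [OF G] gaussian_unitary_carrier [OF H] \<chi>'(1)]
      \<chi>(2) \<chi>'(2) by simp
  moreover have "n - Suc r + 1 = n - r" using Suc.prems by simp
  ultimately show ?case
    using gaussian_unitary_mult [OF G H] \<chi>' by metis
qed

section \<open>Norms, and the compression theorem\<close>

lemma cscalar_prod_sum:
  fixes u v :: "complex vec"
  assumes "u \<in> carrier_vec d" "v \<in> carrier_vec d"
  shows "u \<bullet>c v = (\<Sum>i<d. u $ i * cnj (v $ i))"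
  using assms by (simp add: scalar_prod_def lessThan_atLeast0)

lemma cscalar_prod_adjoint:
  fixes u v :: "complex vec"
  assumes A: "A \<in> carrier_mat d d" and u: "u \<in> carrier_vec d" and v: "v \<in> carrier_vec d"
  shows "(A *\<^sub>v u) \<bullet>c v = u \<bullet>c (mat_adjoint A *\<^sub>v v)"
proof -
  have A': "mat_adjoint A \<in> carrier_mat d d" using A by simp
  have "(A *\<^sub>v u) \<bullet>c v = (\<Sum>i<d. \<Sum>j<d. u $ j * (A $$ (i, j) * cnj (v $ i)))"
    unfolding cscalar_prod_sum [OF mult_mat_vec_carrier [OF A u] v]
    by (rule sum.cong) (simp_all add: index_mult_mat_vec_sum [OF A u] sum_distrib_right mult.assoc
        mult.left_commute [of "A $$ _"] del: index_mult_mat_vec)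
  also have "\<dots> = (\<Sum>j<d. \<Sum>i<d. u $ j * (A $$ (i, j) * cnj (v $ i)))" by (rule sum.swap)
  also have "\<dots> = u \<bullet>c (mat_adjoint A *\<^sub>v v)"
    unfolding cscalar_prod_sum [OF u mult_mat_vec_carrier [OF A' v]]
    by (rule sum.cong)
      (use A in \<open>simp_all add: index_mult_mat_vec_sum [OF A' v] index_mat_adjoint sum_distrib_left del: index_mult_mat_vec\<close>)
  finally show ?thesis .
qed

lemma unitary_norm:
  assumes U: "unitary_mat d U" and u: "u \<in> carrier_vec d"
  shows "(U *\<^sub>v u) \<bullet>c (U *\<^sub>v u) = u \<bullet>c u"
proof -
  note U' = unitary_matD [OF U]
  have "mat_adjoint U *\<^sub>v (U *\<^sub>v u) = u"
    using assoc_mult_mat_vec [OF U'(2,1) u] U'(3) u by simp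
  then show ?thesis
    using cscalar_prod_adjoint [OF U'(1) u mult_mat_vec_carrier [OF U'(1) u]] by simp
qed

text \<open>Only indices whose low part is 0 carry an amplitude. This passes the normalisation of
  the full state to the factor read off from it.\<close>

lemma kron_zero_state_norm:
  assumes \<phi>: "\<phi> \<in> carrier_vec (2 ^ s)"
  shows "kron_vec \<phi> (zero_state r) \<bullet>c kron_vec \<phi> (zero_state r) = \<phi> \<bullet>c \<phi>"
proof -
  let ?k = "kron_vec \<phi> (zero_state r)"
  have k: "?k \<in> carrier_vec (2 ^ s * 2 ^ r)"
    using \<phi> by (simp add: kron_vec_def zero_state_def)
  have "?k \<bullet>c ?k = (\<Sum>a<2 ^ s. \<Sum>b<2 ^ r. ?k $ (a * 2 ^ r + b) * cnj (?k $ (a * 2 ^ r + b)))"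
    unfolding cscalar_prod_sum [OF k k] by (rule sum_lessThan_mult)
  also have "\<dots> = (\<Sum>a<2 ^ s. \<Sum>b<2 ^ r. if b = (0 :: nat) then \<phi> $ a * cnj (\<phi> $ a) else 0)"
  proof (intro sum.cong refl)
    fix a b :: nat assume ab: "a \<in> {..<2 ^ s}" "b \<in> {..<2 ^ r}"
    have "a * 2 ^ r + b < Suc a * 2 ^ r" using ab by simp
    also have "\<dots> \<le> 2 ^ s * 2 ^ r" using ab by (intro mult_right_mono) auto
    finally have "?k $ (a * 2 ^ r + b) = (if b = 0 then \<phi> $ a else 0)"
      using \<phi> ab by (simp add: kron_vec_def zero_state_def)
    then show "?k $ (a * 2 ^ r + b) * cnj (?k $ (a * 2 ^ r + b)) = (if b = 0 then \<phi> $ a * cnj (\<phi> $ a) else 0)"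
      by simp
  qed
  also have "\<dots> = \<phi> \<bullet>c \<phi>" unfolding cscalar_prod_sum [OF \<phi> \<phi>] by simp
  finally show ?thesis .
qed

theorem theorem3:
  fixes n t \<kappa> :: nat and \<psi> :: "complex vec"
  assumes "n \<ge> 1" and "t \<ge> 1" and "\<kappa> \<ge> 1"
    and "\<kappa> * t \<le> n"
    and "doped_gaussian_state n t \<kappa> \<psi>"
  shows "gaussian_compressible n (\<kappa> * t) \<psi>"
proof -
  let ?s = "\<kappa> * t"
  obtain G W where pure: "pure_state n \<psi>"
    and G: "\<forall>i\<in>{0..t}. gaussian_unitary n (G i)" and W: "\<forall>i\<in>{1..t}. local_gate n \<kappa> (W i)"
    and \<psi>_eq: "\<psi> = doped_circuit G W t *\<^sub>v zero_state n"
    using assms(5) unfolding doped_gaussian_state_def by blast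
  have \<psi>: "\<psi> \<in> carrier_vec (2 ^ n)" "\<psi> \<bullet>c \<psi> = 1" using pure by (auto simp: pure_state_def)
  then have "\<psi> \<noteq> 0\<^sub>v (2 ^ n)" by auto
  \<comment> \<open>The vacuum starts with dimension n and each of the t gates costs at most
    \<kappa>.\<close>
  moreover have "annihilator_dim_ge n (n - ?s) \<psi>"
    unfolding \<psi>_eq
    using annihilator_dim_ge_doped_circuit [OF zero_state_carrier annihilator_dim_ge_zero_state G W] by blast
  ultimately obtain V \<chi> where V: "gaussian_unitary n V" and \<chi>: "\<chi> \<in> carrier_vec (2 ^ n)" "\<psi> = V *\<^sub>v \<chi>"
    and ann: "\<forall>j\<in>{n - (n - ?s) + 1..n}. annihilates n (lowering j) \<chi>"
    using clear_modes [OF \<psi>(1), of "n - ?s" "n - ?s"] by auto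
  define \<phi> where "\<phi> = vec (2 ^ ?s) (\<lambda>i. \<chi> $ (i * 2 ^ (n - ?s)))"
  have \<phi>: "\<phi> \<in> carrier_vec (2 ^ ?s)" by (simp add: \<phi>_def)
  have "n - (n - ?s) = ?s" using assms(4) by simp
  then have \<chi>\<phi>: "\<chi> = kron_vec \<phi> (zero_state (n - ?s))"
    unfolding \<phi>_def using annihilated_product_state [OF assms(4) \<chi>(1)] ann by simp
  have "unitary_mat (2 ^ n) V" using V by (simp add: gaussian_unitary_def)
  then have "\<chi> \<bullet>c \<chi> = 1" using unitary_norm [of "2 ^ n" V \<chi>] \<chi> \<psi>(2) by simp
  then have "\<phi> \<bullet>c \<phi> = 1" unfolding \<chi>\<phi> kron_zero_state_norm [OF \<phi>] .
  then have "pure_state ?s \<phi>" using \<phi> by (simp add: pure_state_def)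
  \<comment> \<open>Positivity of t and \<kappa> supplies the lower bound 1.\<close>
  moreover have "?s \<in> {1..n}" using assms(2,3,4) by (simp add: Suc_le_eq)
  ultimately show ?thesis
    unfolding gaussian_compressible_def using pure V \<chi>(2) \<chi>\<phi> by blast
qed

end
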